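(* Let $H$ be a separable real Hilbert space, $U\subset H$ a closed subspace, and $Q\in L(H)$ a nonnegative self-adjoint nuclear operator such that $U$ and $U^\perp$ are $Q$-invariant. Consider the statistical model $(\mathbb{P}_\vartheta)_{\vartheta\in\Theta}$ on $H$ with $\Theta=U\times(0,\infty)$ and $\mathbb{P}_\vartheta=\mathrm{N}(\zeta,\sigma^2Q)$ for $\vartheta=(\zeta,\sigma)$, with observation $Y$, and let $\widehat{\zeta}(Y):=\Pi_UY$. Let $T\in L(H)$ be a linear operator with $U\subset\ker(T)$ and $\operatorname{tr}(TQT^* )>0$, and define $S\in L(H)$ as $$S:=\frac{T}{\sqrt{\operatorname{tr}(TQT^* )}}.$$ Then: (a) The estimator $\|S(Y)\|^2$ is an unbiased estimator for $\sigma^2$. (b) For each $\vartheta\in\Theta$ the estimators $\widehat{\zeta}(Y)$ and $\|S(Y)\|^2$ are $\mathbb{P}_\vartheta$-independent. (c) For each $\vartheta=(\zeta,\sigma)\in\Theta$ we have $$R_\vartheta\big[\|S(Y)\|^2\big]=2\bigg(\sigma^2\frac{\|TQT^*\|_{L_2}}{\|TQT^*\|_{L_1}}\bigg)^2.$$ In particular, $R_\vartheta[\|S(Y)\|^2]\le2\sigma^4$ for each $\vartheta=(\zeta,\sigma)\in\Theta$.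
   Context: $L(H)$ denotes the bounded linear operators on $H$; $\|\cdot\|_{L_1}$ is the nuclear (trace) norm and $\|\cdot\|_{L_2}$ the Hilbert-Schmidt norm. A subspace $V$ is $Q$-invariant if $Q(V)\subset V$. $\Pi_V$ is the orthogonal projection onto a closed subspace $V$. $\mathrm{N}(\zeta,\sigma^2Q)$ is the Gaussian measure on $H$ with mean $\zeta$ and covariance operator $\sigma^2Q$, i.e. if $Y$ has this law then $\langle b,Y\rangle\sim\mathrm{N}(\langle b,\zeta\rangle,\sigma^2\langle Qb,b\rangle)$ (possibly degenerate) for all $b\in H$. $Y$ is the observation (the identity map on $H$), so $Y\sim\mathrm{N}(\zeta,\sigma^2Q)$ under $\mathbb{P}_\vartheta$, and $\mathbb{E}_\vartheta$ is expectation under $\mathbb{P}_\vartheta$. A real-valued estimator $X$ is unbiased for $\sigma^2$ if $\mathbb{E}_\vartheta[X]=\sigma^2$ for all $\vartheta=(\zeta,\sigma)\in\Theta$, and its risk is $R_\vartheta[X]:=\mathbb{E}_\vartheta[|X-\sigma^2|^2]$. *)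

theory Defs
  imports "HOL-Probability.Probability"
begin

text \<open>
  Separable real Hilbert spaces are the types of sort \<open>{real_inner, polish_space}\<close>:
  complete real inner product spaces which are second countable, which for metric spaces
  is equivalent to separability. Such spaces may have finite or infinite dimension.
\<close>

section \<open>Operators on a Hilbert space\<close>

text \<open>
  Well defined only for closed subspaces \<open>V\<close> of a complete space, where the point exists
  and is unique. (The library's \<open>closest_point\<close> requires \<open>heine_borel\<close>, that is, finite dimension.)
\<close>
definition orth_proj :: "'a::real_inner set \<Rightarrow> 'a \<Rightarrow> 'a" where
  "orth_proj V x = (THE p. p \<in> V \<and> x - p \<in> V\<^sup>\<bottom>)"

definition self_adjoint_op :: "('a::real_inner \<Rightarrow> 'a) \<Rightarrow> bool" where
  "self_adjoint_op A \<longleftrightarrow> (\<forall>x y. A x \<bullet> y = x \<bullet> A y)"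

definition nonneg_op :: "('a::real_inner \<Rightarrow> 'a) \<Rightarrow> bool" where
  "nonneg_op A \<longleftrightarrow> (\<forall>x. 0 \<le> A x \<bullet> x)"

definition invariant_under :: "('a \<Rightarrow> 'a) \<Rightarrow> 'a set \<Rightarrow> bool" where
  "invariant_under A V \<longleftrightarrow> A ` V \<subseteq> V"

definition nuclear_representation ::
    "('a::real_inner \<Rightarrow> 'a) \<Rightarrow> (nat \<Rightarrow> 'a) \<Rightarrow> (nat \<Rightarrow> 'a) \<Rightarrow> bool" where
  "nuclear_representation A a b \<longleftrightarrow>
     summable (\<lambda>n. norm (a n) * norm (b n)) \<and>
     (\<forall>x. (\<lambda>n. (a n \<bullet> x) *\<^sub>R b n) sums A x)"

definition nuclear_op :: "('a::real_inner \<Rightarrow> 'a) \<Rightarrow> bool" where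
  "nuclear_op A \<longleftrightarrow> (\<exists>a b. nuclear_representation A a b)"

text \<open>Meaningful only for nuclear operators; otherwise it is the infimum of the empty set.\<close>
definition nuclear_norm :: "('a::real_inner \<Rightarrow> 'a) \<Rightarrow> real" where
  "nuclear_norm A =
     Inf {(\<Sum>n. norm (a n) * norm (b n)) | a b. nuclear_representation A a b}"

definition orthonormal_basis :: "'a::real_inner set \<Rightarrow> bool" where
  "orthonormal_basis B \<longleftrightarrow>
     pairwise orthogonal B \<and> (\<forall>e\<in>B. norm e = 1) \<and> closure (span B) = UNIV"

text \<open>
  The trace of a nuclear operator and the Hilbert-Schmidt norm of a Hilbert-Schmidt operator
  do not depend on the orthonormal basis, so an arbitrary one is chosen. A basis is a
  possibly finite set, hence the unordered sums.
\<close>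
definition op_trace :: "('a::real_inner \<Rightarrow> 'a) \<Rightarrow> real" where
  "op_trace A = (\<Sum>\<^sub>\<infinity>e\<in>(SOME B. orthonormal_basis B). A e \<bullet> e)"

definition hilbert_schmidt_norm :: "('a::real_inner \<Rightarrow> 'a) \<Rightarrow> real" where
  "hilbert_schmidt_norm A = sqrt (\<Sum>\<^sub>\<infinity>e\<in>(SOME B. orthonormal_basis B). (norm (A e))\<^sup>2)"

section \<open>Gaussian measures\<close>

text \<open>The second argument is the variance; variance zero gives a point mass.\<close>
definition normal_law :: "real \<Rightarrow> real \<Rightarrow> real measure" where
  "normal_law m v =
     (if v = 0 then return borel m else density lborel (\<lambda>x. ennreal (normal_density m (sqrt v) x)))"

text \<open>
  \<open>gaussian_measure M m C\<close> states that \<open>M\<close> is the Gaussian measure with mean \<open>m\<close> and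
  covariance operator \<open>C\<close>. A Borel measure on a separable Hilbert space is determined by the
  laws of its one-dimensional projections, so there is at most one such \<open>M\<close>.
\<close>
definition gaussian_measure ::
    "'a::{real_inner, polish_space} measure \<Rightarrow> 'a \<Rightarrow> ('a \<Rightarrow> 'a) \<Rightarrow> bool" where
  "gaussian_measure M m C \<longleftrightarrow>
     prob_space M \<and> sets M = sets borel \<and>
     (\<forall>b. distr M borel (\<lambda>y. b \<bullet> y) = normal_law (b \<bullet> m) (C b \<bullet> b))"

section \<open>Estimators and independence\<close>

text \<open>Integrability is required since the Bochner integral of a non-integrable function is 0.\<close>
definition unbiased_estimator ::
    "('p \<Rightarrow> 'b measure) \<Rightarrow> 'p set \<Rightarrow> ('b \<Rightarrow> real) \<Rightarrow> ('p \<Rightarrow> real) \<Rightarrow> bool" where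
  "unbiased_estimator P \<Theta> X g \<longleftrightarrow>
     (\<forall>\<theta>\<in>\<Theta>. integrable (P \<theta>) X \<and> (\<integral>y. X y \<partial>P \<theta>) = g \<theta>)"

text \<open>The quadratic risk is extended-real valued, so that a finite value entails finite second moment.\<close>
definition quadratic_risk :: "'b measure \<Rightarrow> ('b \<Rightarrow> real) \<Rightarrow> real \<Rightarrow> ennreal" where
  "quadratic_risk M X g = (\<integral>\<^sup>+y. ennreal (\<bar>X y - g\<bar>\<^sup>2) \<partial>M)"

text \<open>
  The library's \<open>prob_space.indep_var\<close> requires both random variables to take values in the
  same type. This is the right-hand side of \<open>prob_space.indep_var_eq\<close> for arbitrary value types.
\<close>
definition indep_random_variables ::
    "'b measure \<Rightarrow> 'c measure \<Rightarrow> ('b \<Rightarrow> 'c) \<Rightarrow> 'd measure \<Rightarrow> ('b \<Rightarrow> 'd) \<Rightarrow> bool" where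
  "indep_random_variables M N X K Z \<longleftrightarrow>
     X \<in> measurable M N \<and> Z \<in> measurable M K \<and>
     prob_space.indep_set M
       (sigma_sets (space M) {X -` A \<inter> space M | A. A \<in> sets N})
       (sigma_sets (space M) {Z -` A \<inter> space M | A. A \<in> sets K})"

end

theory Submission
  imports Defs
begin

text \<open>
  Write \<open>K = T Q T\<^sup>*\<close> and let \<open>e\<^sub>n\<close> be an orthonormal basis. Since \<open>T\<close> vanishes on \<open>U\<close>, under
  each measure of the model \<open>T Y\<close> is centred Gaussian with covariance \<open>\<sigma>\<^sup>2 K\<close>, so its coordinates
  \<open>\<langle>T Y, e\<^sub>n\<rangle>\<close> are centred Gaussian variables whose covariances are the matrix entries of
  \<open>\<sigma>\<^sup>2 K\<close>. Parseval writes \<open>\<parallel>T Y\<parallel>\<^sup>2\<close> as the sum of their squares. Second moments give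
  \<open>E \<parallel>T Y\<parallel>\<^sup>2 = \<sigma>\<^sup>2 tr K\<close>, and Isserlis' formula \<open>E X\<^sup>2 Z\<^sup>2 = E X\<^sup>2 E Z\<^sup>2 + 2 (E X Z)\<^sup>2\<close> gives
  \<open>E \<parallel>T Y\<parallel>\<^sup>4 = \<sigma>\<^sup>4 ((tr K)\<^sup>2 + 2 \<parallel>K\<parallel>\<^sub>2\<^sup>2)\<close> with the Hilbert-Schmidt norm (\<open>gaussian_norm_moments\<close>).
  Unbiasedness and the value \<open>2 \<sigma>\<^sup>4 \<parallel>K\<parallel>\<^sub>2\<^sup>2 / (tr K)\<^sup>2\<close> of the risk follow. Cauchy-Schwarz for the
  form of \<open>K\<close> bounds the Hilbert-Schmidt norm by the trace (\<open>hilbert_schmidt_le_trace\<close>), hence the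
  risk by \<open>2 \<sigma>\<^sup>4\<close>.

  The risk is stated with the nuclear norm, which equals the trace for a positive operator
  (\<open>nuclear_norm_positive_op\<close>). That no nuclear representation is smaller than the trace is
  Cauchy-Schwarz; a representation attaining the trace comes from a Cholesky decomposition
  \<open>K x = \<Sum> \<langle>c\<^sub>n, x\<rangle> c\<^sub>n\<close> along the basis, for which \<open>\<Sum> \<parallel>c\<^sub>n\<parallel>\<^sup>2\<close> is at
  most the trace by Parseval. Trace and Hilbert-Schmidt norm are computed in the basis that
  their definitions choose.

  For independence, the invariance of \<open>U\<close> under \<open>Q\<close> makes every functional of \<open>\<Pi>\<^sub>U Y\<close> uncorrelated
  with every functional of \<open>T Y\<close>, so the joint characteristic functional factorizes. A measure is
  Gaussian here by virtue of its one-dimensional projections, and passing from characteristic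
  functionals to events needs Fourier uniqueness on the Hilbert space
  (\<open>fourier_null_imp_null_hilbert\<close>), which is reduced to uniqueness on the line by
  allowing complex weights.
\<close>

section \<open>Projections, adjoints and bases in a separable Hilbert space\<close>

text \<open>
  A minimizing sequence for the distance from \<open>x\<close> to \<open>V\<close> is Cauchy by the parallelogram
  identity, and at its limit the first variation of the distance vanishes in every direction
  of \<open>V\<close>.
\<close>
lemma orthogonal_projection_exists:
  fixes V :: "'a::{real_inner, complete_space} set"
  assumes V: "subspace V" "closed V"
  shows "\<exists>p\<in>V. x - p \<in> V\<^sup>\<bottom>"
proof -
  define d where "d = (INF v\<in>V. (norm (x - v))\<^sup>2)"
  have bdd: "bdd_below ((\<lambda>v. (norm (x - v))\<^sup>2) ` V)"
    by (rule bdd_belowI[of _ 0]) auto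
  have ne: "V \<noteq> {}" using V(1) subspace_0 by blast
  have d_le: "d \<le> (norm (x - v))\<^sup>2" if "v \<in> V" for v
    unfolding d_def using that bdd by (rule cINF_lower[rotated])
  have "\<exists>v\<in>V. (norm (x - v))\<^sup>2 < d + 1 / Suc n" for n
  proof -
    have "(INF v\<in>V. (norm (x - v))\<^sup>2) < d + 1 / Suc n" unfolding d_def by simp
    then show ?thesis using cINF_less_iff[OF ne bdd] by blast
  qed
  then obtain v where vV: "\<And>n. v n \<in> V" and vd: "\<And>n. (norm (x - v n))\<^sup>2 < d + 1 / Suc n"
    by metis
  have close: "(norm (v m - v n))\<^sup>2 \<le> 2 / Suc m + 2 / Suc n" for m n
  proof -
    have "(1/2) *\<^sub>R (v m + v n) \<in> V"
      using V(1) vV by (simp add: subspace_add subspace_scale)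
    from d_le[OF this] have "4 * d \<le> 4 * (norm (x - (1/2) *\<^sub>R (v m + v n)))\<^sup>2" by simp
    moreover have "(norm (v m - v n))\<^sup>2 = 2 * (norm (x - v m))\<^sup>2 + 2 * (norm (x - v n))\<^sup>2
        - 4 * (norm (x - (1/2) *\<^sub>R (v m + v n)))\<^sup>2"
      by (simp add: power2_norm_eq_inner algebra_simps inner_commute)
    ultimately show ?thesis using vd[of m] vd[of n] by argo
  qed
  have "Cauchy v"
  proof (rule CauchyI')
    fix e :: real assume e: "e > 0"
    obtain M where M: "4 / e\<^sup>2 < real M" using reals_Archimedean2 by blast
    have "norm (v m - v n) < e" if "M \<le> m" "m < n" for m n
    proof -
      have "2 / Suc m \<le> 2 / Suc M" "2 / Suc n \<le> 2 / Suc M"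
        using that by (auto intro!: divide_left_mono)
      then have "(norm (v m - v n))\<^sup>2 \<le> 4 / Suc M" using close[of m n] by simp
      also have "\<dots> < e\<^sup>2" using M e
        by (simp add: divide_simps) (simp add: algebra_simps add_strict_increasing)
      finally show ?thesis using e by (simp add: power_less_imp_less_base)
    qed
    then show "\<exists>M. \<forall>m\<ge>M. \<forall>n>m. dist (v m) (v n) < e" by (auto simp: dist_norm)
  qed
  then obtain p where p: "v \<longlonglongrightarrow> p" using Cauchy_convergent_iff convergent_def by blast
  have pV: "p \<in> V" using V(2) vV p closed_sequentially by blast
  have "(norm (x - p))\<^sup>2 \<le> d"
  proof (rule LIMSEQ_le)
    show "(\<lambda>n. (norm (x - v n))\<^sup>2) \<longlonglongrightarrow> (norm (x - p))\<^sup>2" by (intro tendsto_intros p)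
    show "(\<lambda>n. d + 1 / Suc n) \<longlonglongrightarrow> d"
      using tendsto_add[OF tendsto_const LIMSEQ_inverse_real_of_nat, of d]
      by (simp add: inverse_eq_divide)
  qed (use vd less_imp_le in blast)
  have "u \<bullet> (x - p) = 0" if u: "u \<in> V" for u
  proof (cases "u = 0")
    case False
    \<comment> \<open>The minimizer of the distance from \<open>x\<close> along the line through \<open>p\<close> in direction \<open>u\<close>.\<close>
    define t where "t = (u \<bullet> (x - p)) / (u \<bullet> u)"
    have "p + t *\<^sub>R u \<in> V" using V(1) pV u by (simp add: subspace_add subspace_scale)
    from d_le[OF this] have "(norm (x - p))\<^sup>2 \<le> (norm (x - p - t *\<^sub>R u))\<^sup>2"
      using \<open>(norm (x - p))\<^sup>2 \<le> d\<close> unfolding diff_diff_eq by linarith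
    also have "\<dots> = (norm (x - p))\<^sup>2 - 2 * t * (u \<bullet> (x - p)) + t\<^sup>2 * (u \<bullet> u)"
      unfolding power2_norm_eq_inner
      by (simp add: inner_diff_left inner_diff_right inner_commute power2_eq_square algebra_simps)
    also have "\<dots> = (norm (x - p))\<^sup>2 - (u \<bullet> (x - p))\<^sup>2 / (u \<bullet> u)"
      using False by (simp add: t_def power2_eq_square)
    finally show ?thesis using False
      by (simp add: divide_le_0_iff power2_eq_square) (smt (verit) inner_gt_zero_iff not_sum_squares_lt_zero
          sum_squares_le_zero_iff zero_less_divide_iff mult_eq_0_iff)
  qed simp
  then show ?thesis using pV by (auto simp: orthogonal_comp_def orthogonal_def)
qed

context
  fixes V :: "'a::{real_inner, complete_space} set"
  assumes V: "subspace V" "closed V"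
begin

lemma orth_proj_eqI:
  assumes "p \<in> V" "x - p \<in> V\<^sup>\<bottom>"
  shows "orth_proj V x = p"
  unfolding orth_proj_def
proof (rule the_equality)
  fix q assume q: "q \<in> V \<and> x - q \<in> V\<^sup>\<bottom>"
  have "p - q \<in> V" using q assms V(1) subspace_diff by blast
  moreover have "(x - q) - (x - p) \<in> V\<^sup>\<bottom>"
    using q assms subspace_orthogonal_comp subspace_diff by blast
  ultimately have "(p - q) \<bullet> (p - q) = 0"
    by (simp add: orthogonal_comp_def orthogonal_def)
  then show "q = p" by simp
qed (use assms in auto)

lemma orth_proj_mem: "orth_proj V x \<in> V"
  and orth_proj_residual: "x - orth_proj V x \<in> V\<^sup>\<bottom>"
  using orthogonal_projection_exists[OF V, of x] orth_proj_eqI by blast+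

lemma inner_orth_proj: "u \<in> V \<Longrightarrow> u \<bullet> orth_proj V x = u \<bullet> x"
  using orth_proj_residual[of x] by (simp add: orthogonal_comp_def orthogonal_def inner_diff_right)

lemma orth_proj_self_adjoint: "orth_proj V x \<bullet> y = x \<bullet> orth_proj V y"
  using inner_orth_proj[OF orth_proj_mem, of x y] inner_orth_proj[OF orth_proj_mem, of y x]
  by (simp add: inner_commute)

lemma bounded_linear_orth_proj: "bounded_linear (orth_proj V)"
proof (rule bounded_linear_intro[where K = 1])
  fix x y r
  have "x + y - (orth_proj V x + orth_proj V y) \<in> V\<^sup>\<bottom>"
    using subspace_add[OF subspace_orthogonal_comp orth_proj_residual[of x] orth_proj_residual[of y]]
    by (simp add: algebra_simps)
  then show "orth_proj V (x + y) = orth_proj V x + orth_proj V y"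
    by (intro orth_proj_eqI subspace_add[OF V(1)] orth_proj_mem)
  have "r *\<^sub>R x - r *\<^sub>R orth_proj V x \<in> V\<^sup>\<bottom>"
    using subspace_scale[OF subspace_orthogonal_comp orth_proj_residual[of x], of r]
    by (simp add: algebra_simps)
  then show "orth_proj V (r *\<^sub>R x) = r *\<^sub>R orth_proj V x"
    by (intro orth_proj_eqI subspace_scale[OF V(1)] orth_proj_mem)
  have "(norm (orth_proj V x))\<^sup>2 = orth_proj V x \<bullet> x"
    by (simp add: power2_norm_eq_inner inner_orth_proj orth_proj_mem)
  also have "\<dots> \<le> norm (orth_proj V x) * norm x" by (rule norm_cauchy_schwarz)
  finally show "norm (orth_proj V x) \<le> norm x * 1"
    by (cases "orth_proj V x = 0") (auto simp: power2_eq_square)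
qed

end

text \<open>
  A nonzero functional \<open>f\<close> is proportional to the inner product with any vector orthogonal to
  its kernel, since modulo the kernel the space is one-dimensional.
\<close>
lemma riesz_representation:
  fixes f :: "'a::{real_inner, complete_space} \<Rightarrow> real"
  assumes f: "bounded_linear f"
  shows "\<exists>a. \<forall>x. f x = x \<bullet> a"
proof (cases "\<forall>x. f x = 0")
  case True
  then show ?thesis by (intro exI[of _ 0]) simp
next
  case False
  then obtain z where z: "f z \<noteq> 0" by blast
  interpret f: bounded_linear f by (rule f)
  define V where "V = {x. f x = 0}"
  have V: "subspace V" "closed V"
    unfolding V_def by (auto simp: subspace_def f.add f.scaleR f.zero
        intro!: closed_Collect_eq f.continuous_on continuous_on_id)
  define w where "w = z - orth_proj V z"
  have fw: "f w = f z" using orth_proj_mem[OF V, of z] by (simp add: w_def f.diff V_def)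
  then have w0: "w \<noteq> 0" using z f.zero by auto
  have "f x = x \<bullet> ((f w / (w \<bullet> w)) *\<^sub>R w)" for x
  proof -
    have "x - (f x / f w) *\<^sub>R w \<in> V" using z fw by (simp add: V_def f.diff f.scaleR)
    then have "(x - (f x / f w) *\<^sub>R w) \<bullet> w = 0"
      using orth_proj_residual[OF V, of z] by (simp add: w_def orthogonal_comp_def orthogonal_def)
    then show ?thesis using w0 z fw by (simp add: inner_diff_left field_simps)
  qed
  then show ?thesis by blast
qed

lemma inner_adjoint:
  fixes T :: "'a::{real_inner, complete_space} \<Rightarrow> 'b::real_inner"
  assumes T: "bounded_linear T"
  shows "T x \<bullet> y = x \<bullet> adjoint T y"
proof -
  have "\<forall>y. \<exists>a. \<forall>x. T x \<bullet> y = x \<bullet> a"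
    using T by (intro allI riesz_representation bounded_linear_inner_left_comp)
  then obtain g where "\<forall>x y. T x \<bullet> y = x \<bullet> g y" by metis
  then have "\<forall>x y. T x \<bullet> y = x \<bullet> adjoint T y"
    unfolding adjoint_def by (rule someI[where P = "\<lambda>g. \<forall>x y. T x \<bullet> y = x \<bullet> g y"])
  then show ?thesis by blast
qed

lemma bounded_linear_adjoint:
  fixes T :: "'a::{real_inner, complete_space} \<Rightarrow> 'b::real_inner"
  assumes T: "bounded_linear T"
  shows "bounded_linear (adjoint T)"
proof -
  obtain C where C: "\<And>x. norm (T x) \<le> norm x * C" and C0: "0 \<le> C"
    using bounded_linear.nonneg_bounded[OF T] by blast
  have eqI: "u = v" if "\<And>x. x \<bullet> u = x \<bullet> v" for u v :: 'a
    using that[of "u - v"] by (metis inner_diff_right inner_eq_zero_iff right_minus_eq)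
  show ?thesis
  proof (rule bounded_linear_intro[where K = C])
    fix x y r
    show "adjoint T (x + y) = adjoint T x + adjoint T y"
      by (rule eqI) (simp add: inner_add_right flip: inner_adjoint[OF T])
    show "adjoint T (r *\<^sub>R x) = r *\<^sub>R adjoint T x"
      by (rule eqI) (simp flip: inner_adjoint[OF T])
    have "(norm (adjoint T x))\<^sup>2 = T (adjoint T x) \<bullet> x"
      by (simp add: power2_norm_eq_inner inner_adjoint[OF T])
    also have "\<dots> \<le> norm (T (adjoint T x)) * norm x" by (rule norm_cauchy_schwarz)
    also have "\<dots> \<le> norm (adjoint T x) * C * norm x"
      by (intro mult_right_mono C) auto
    finally show "norm (adjoint T x) \<le> norm x * C"
      using C0 by (cases "adjoint T x = 0") (auto simp: power2_eq_square mult.assoc mult.commute)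
  qed
qed

lemma subspace_closure:
  fixes V :: "'a::real_normed_vector set"
  assumes "subspace V"
  shows "subspace (closure V)"
proof (rule subspaceI)
  show "0 \<in> closure V" using assms closure_subset subspace_0 by blast
  fix x y r assume "x \<in> closure V" "y \<in> closure V"
  then obtain f g where fg: "\<And>n::nat. f n \<in> V" "f \<longlonglongrightarrow> x" "\<And>n::nat. g n \<in> V" "g \<longlonglongrightarrow> y"
    unfolding closure_sequential by metis
  have "(\<lambda>n. f n + g n) \<longlonglongrightarrow> x + y" "(\<lambda>n. r *\<^sub>R f n) \<longlonglongrightarrow> r *\<^sub>R x"
    by (intro tendsto_intros fg)+
  moreover have "f n + g n \<in> V" "r *\<^sub>R f n \<in> V" for n
    using fg assms by (auto simp: subspace_add subspace_scale)
  ultimately show "x + y \<in> closure V" "r *\<^sub>R x \<in> closure V"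
    unfolding closure_sequential by metis+
qed

text \<open>
  A maximal orthonormal set is a basis: a vector outside its closed span would, after
  subtracting its projection and normalizing, enlarge the set.
\<close>
lemma orthonormal_basis_exists:
  "\<exists>B :: 'a::{real_inner, complete_space} set. orthonormal_basis B"
proof -
  define \<O> where "\<O> = {B :: 'a set. pairwise orthogonal B \<and> (\<forall>e\<in>B. norm e = 1)}"
  have "\<exists>M\<in>\<O>. \<forall>X\<in>\<O>. M \<subseteq> X \<longrightarrow> X = M"
  proof (rule subset_Zorn')
    fix \<C> assume C: "subset.chain \<O> \<C>"
    have "pairwise orthogonal (\<Union>\<C>)"
    proof (rule pairwiseI)
      fix x y assume "x \<in> \<Union>\<C>" "y \<in> \<Union>\<C>" and xy: "x \<noteq> y"
      then obtain X Y where XY: "X \<in> \<C>" "Y \<in> \<C>" "x \<in> X" "y \<in> Y" by blast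
      then have "X \<subseteq> Y \<or> Y \<subseteq> X" using C by (auto simp: subset.chain_def)
      then obtain Z where "Z \<in> \<C>" "x \<in> Z" "y \<in> Z" using XY by blast
      then show "orthogonal x y"
        using C xy by (auto simp: subset.chain_def \<O>_def pairwise_def)
    qed
    then show "\<Union>\<C> \<in> \<O>" using C by (auto simp: subset.chain_def \<O>_def)
  qed
  then obtain B where B: "B \<in> \<O>" and max: "\<And>X. X \<in> \<O> \<Longrightarrow> B \<subseteq> X \<Longrightarrow> X = B" by blast
  define V where "V = closure (span B)"
  have V: "subspace V" "closed V"
    by (simp_all add: V_def subspace_closure)
  have BV: "B \<subseteq> V" unfolding V_def using closure_subset span_superset by blast
  have "x \<in> V" for x
  proof (rule ccontr)
    assume x: "x \<notin> V"
    define w where "w = x - orth_proj V x"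
    have w0: "w \<noteq> 0" using x orth_proj_mem[OF V, of x] by (auto simp: w_def)
    have wV: "v \<bullet> w = 0" if "v \<in> V" for v
      using orth_proj_residual[OF V, of x] that by (simp add: w_def orthogonal_comp_def orthogonal_def)
    have "pairwise orthogonal (insert (w /\<^sub>R norm w) B)"
      using B BV wV
      by (auto simp: pairwise_insert \<O>_def orthogonal_def inner_commute)
    then have "insert (w /\<^sub>R norm w) B \<in> \<O>" using B w0 by (auto simp: \<O>_def)
    from max[OF this] have "w /\<^sub>R norm w \<in> V" using BV by blast
    from wV[OF this] show False using w0 by simp
  qed
  then show ?thesis using B by (auto simp: orthonormal_basis_def \<O>_def V_def)
qed

text \<open>
  An orthonormal basis listed as a sequence, with zeros in unused places so that finite and
  infinite dimension are covered at once. Zero entries contribute nothing to the expansions.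
\<close>
definition basis_seq :: "(nat \<Rightarrow> 'a::real_inner) \<Rightarrow> bool" where
  "basis_seq e \<longleftrightarrow> (\<forall>i j. i \<noteq> j \<longrightarrow> e i \<bullet> e j = 0) \<and> (\<forall>i. e i \<noteq> 0 \<longrightarrow> norm (e i) = 1)
     \<and> closure (span (range e)) = UNIV"

text \<open>
  Distinct basis vectors have distance \<open>sqrt 2\<close>, so the balls of radius \<open>1/2\<close> around them are
  disjoint, and separability allows only countably many.
\<close>
lemma countable_orthonormal_basis:
  fixes B :: "'a::{real_inner, second_countable_topology} set"
  assumes B: "orthonormal_basis B"
  shows "countable B"
proof -
  have far: "dist x y > 1" if "x \<in> B" "y \<in> B" "x \<noteq> y" for x y
  proof -
    have "x \<bullet> y = 0" "norm x = 1" "norm y = 1"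
      using B that by (auto simp: orthonormal_basis_def pairwise_def orthogonal_def)
    then have "(dist x y)\<^sup>2 = 2"
      by (simp add: dist_norm power2_norm_eq_inner inner_diff_left inner_diff_right inner_commute)
         (simp add: norm_eq_1)
    then show ?thesis by (smt (verit) power2_eq_square mult_le_one zero_le_dist mult_left_le)
  qed
  have disj: "ball x (1/2) \<inter> ball y (1/2) = {}" if "x \<in> B" "y \<in> B" "x \<noteq> y" for x y
    using far[OF that] by (auto simp: disjoint_iff) (smt (verit) dist_commute dist_triangle2 field_sum_of_halves)
  have "countable ((\<lambda>x. ball x (1/2)) ` B)"
    by (rule countable_disjoint_open_subsets) (use disj in \<open>auto simp: disjoint_def\<close>)
  moreover have "inj_on (\<lambda>x. ball x (1/2)) B"
  proof (rule inj_onI, rule ccontr)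
    fix x y assume "x \<in> B" "y \<in> B" "ball x (1/2) = ball y (1/2)" "x \<noteq> y"
    with disj[of x y] show False by auto
  qed
  ultimately show ?thesis by (rule countable_image_inj_on)
qed

text \<open>
  Every basis sum needed later has nonnegative terms vanishing at \<open>0\<close>, so it is unaffected by the
  order of enumeration and by the padding.
\<close>
lemma orthonormal_basis_enumeration:
  fixes B :: "'a::{real_inner, second_countable_topology} set"
  assumes B: "orthonormal_basis B"
  obtains e where "basis_seq e"
    and "\<forall>f s. f 0 = 0 \<longrightarrow> (\<forall>x. f x \<ge> (0::real)) \<longrightarrow> ((f has_sum s) B \<longleftrightarrow> (\<lambda>n. f (e n)) sums s)"
proof -
  define I where "I = to_nat_on B ` B"
  define e where "e n = (if n \<in> I then from_nat_into B n else 0)" for n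
  have cB: "countable B" by (rule countable_orthonormal_basis[OF B])
  have inj: "inj_on (to_nat_on B) B" using cB by (rule inj_on_to_nat_on)
  have e_to: "e (to_nat_on B b) = b" if "b \<in> B" for b
    using that cB by (simp add: e_def I_def)
  have e_in: "n \<in> I \<Longrightarrow> e n \<in> B \<and> to_nat_on B (e n) = n" for n
    using e_to by (auto simp: I_def)
  have e_out: "n \<notin> I \<Longrightarrow> e n = 0" for n by (simp add: e_def)
  have orth: "e i \<bullet> e j = 0" if "i \<noteq> j" for i j
  proof (cases "i \<in> I \<and> j \<in> I")
    case True
    then have "e i \<in> B" "e j \<in> B" "e i \<noteq> e j" using e_in that by metis+
    then show ?thesis using B by (auto simp: orthonormal_basis_def pairwise_def orthogonal_def)
  qed (use e_out in auto)
  have unit: "norm (e i) = 1" if "e i \<noteq> 0" for i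
    using that e_in[of i] e_out[of i] B by (auto simp: orthonormal_basis_def)
  have "B \<subseteq> range e" using e_to by (metis rangeI subsetI)
  then have "closure (span B) \<subseteq> closure (span (range e))" by (intro closure_mono span_mono)
  then have "basis_seq e" using B orth unit by (auto simp: basis_seq_def orthonormal_basis_def)
  moreover have "(f has_sum s) B \<longleftrightarrow> (\<lambda>n. f (e n)) sums s"
    if f: "f 0 = 0" "\<And>x. f x \<ge> (0::real)" for f s
  proof -
    have "(f has_sum s) B \<longleftrightarrow> ((\<lambda>n. f (e n)) \<circ> to_nat_on B has_sum s) B"
      by (rule has_sum_cong) (simp add: e_to)
    also have "\<dots> \<longleftrightarrow> ((\<lambda>n. f (e n)) has_sum s) I"
      unfolding I_def by (rule has_sum_reindex[OF inj, symmetric])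
    also have "\<dots> \<longleftrightarrow> ((\<lambda>n. f (e n)) has_sum s) UNIV"
      by (rule has_sum_cong_neutral) (use e_out f in auto)
    also have "\<dots> \<longleftrightarrow> (\<lambda>n. f (e n)) sums s"
      using has_sum_imp_sums sums_nonneg_imp_has_sum[of "\<lambda>n. f (e n)" s] f(2) by blast
    finally show ?thesis .
  qed
  ultimately show ?thesis using that by blast
qed

text \<open>
  Strong convergence to zero only has to be checked on a total set when the operators are
  uniformly bounded. This gives the convergence of orthonormal expansions, and below that of
  the pivoting scheme for positive operators.
\<close>
lemma tendsto_zero_on_total_set:
  fixes A :: "nat \<Rightarrow> 'a::real_inner \<Rightarrow> 'b::real_normed_vector"
  assumes lin: "\<And>n. linear (A n)"
    and bound: "\<And>n x. norm (A n x) \<le> C * norm x"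
    and total: "closure (span G) = UNIV"
    and zero: "\<And>g. g \<in> G \<Longrightarrow> \<forall>\<^sub>F n in sequentially. A n g = 0"
  shows "(\<lambda>n. A n x) \<longlonglongrightarrow> 0"
proof (rule tendstoI)
  fix \<epsilon> :: real assume \<epsilon>: "\<epsilon> > 0"
  define D where "D = \<bar>C\<bar> + 1"
  have D: "D > 0" and boundD: "norm (A n x) \<le> D * norm x" for n x
    using order.trans[OF bound mult_right_mono[of C D "norm x"]] by (auto simp: D_def)
  have "x \<in> closure (span G)" using total by simp
  then obtain y where y: "y \<in> span G" "dist y x < \<epsilon> / D"
    using \<epsilon> D unfolding closure_approachable by (meson divide_pos_pos)
  have "\<forall>\<^sub>F n in sequentially. A n y = 0"
    using y(1)
  proof (induction rule: span_induct_alt)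
    case base
    then show ?case by (simp add: linear_0[OF lin])
  next
    case (step c g z)
    from eventually_conj[OF zero[OF step(1)] step(2)] show ?case
      by (rule eventually_mono) (simp add: linear_add[OF lin] linear_scale[OF lin])
  qed
  then show "\<forall>\<^sub>F n in sequentially. dist (A n x) 0 < \<epsilon>"
  proof (rule eventually_mono)
    fix n assume "A n y = 0"
    then have "A n x = A n (x - y)" by (simp add: linear_diff[OF lin])
    then have "norm (A n x) \<le> D * norm (x - y)" using boundD by simp
    also have "\<dots> < \<epsilon>" using y(2) D by (simp add: dist_norm norm_minus_commute pos_less_divide_eq mult.commute)
    finally show "dist (A n x) 0 < \<epsilon>" by simp
  qed
qed

context
  fixes e :: "nat \<Rightarrow> 'a::real_inner"
  assumes e: "basis_seq e"
begin

lemma inner_basis_seq: "i \<noteq> j \<Longrightarrow> e i \<bullet> e j = 0"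
  and inner_basis_seq_self: "(x \<bullet> e i) * (e i \<bullet> e i) = x \<bullet> e i"
  and total_basis_seq: "closure (span (range e)) = UNIV"
  using e by (auto simp: basis_seq_def) (metis inner_zero_right mult_cancel_left2 norm_eq_1)

lemma expansion_inner_basis_seq:
  "(\<Sum>n<N. (x \<bullet> e n) *\<^sub>R e n) \<bullet> e j = (if j < N then x \<bullet> e j else 0)"
proof -
  have "(\<Sum>n<N. (x \<bullet> e n) *\<^sub>R e n) \<bullet> e j = (\<Sum>n<N. if n = j then x \<bullet> e j else 0)"
    unfolding inner_sum_left
    by (rule sum.cong) (auto simp: inner_basis_seq inner_basis_seq_self)
  then show ?thesis by simp
qed

lemma bessel_pythagoras:
  "(norm x)\<^sup>2 = (norm (x - (\<Sum>n<N. (x \<bullet> e n) *\<^sub>R e n)))\<^sup>2 + (norm (\<Sum>n<N. (x \<bullet> e n) *\<^sub>R e n))\<^sup>2"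
proof -
  define p where "p = (\<Sum>n<N. (x \<bullet> e n) *\<^sub>R e n)"
  have "p \<bullet> p = (\<Sum>n<N. (x \<bullet> e n) * (p \<bullet> e n))"
    by (subst (2) p_def) (simp add: inner_sum_right)
  also have "\<dots> = (\<Sum>n<N. (x \<bullet> e n) * (x \<bullet> e n))"
    by (rule sum.cong) (simp_all add: p_def expansion_inner_basis_seq)
  also have "\<dots> = x \<bullet> p" by (simp add: p_def inner_sum_right)
  finally show ?thesis unfolding p_def[symmetric] power2_norm_eq_inner
    by (simp add: inner_diff_left inner_diff_right inner_commute)
qed

lemma basis_seq_expansion: "(\<lambda>n. (x \<bullet> e n) *\<^sub>R e n) sums x"
proof -
  have "(\<lambda>N. x - (\<Sum>n<N. (x \<bullet> e n) *\<^sub>R e n)) \<longlonglongrightarrow> 0"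
  proof (rule tendsto_zero_on_total_set[where C = 1 and G = "range e"])
    fix N
    show "linear (\<lambda>x. x - (\<Sum>n<N. (x \<bullet> e n) *\<^sub>R e n))"
      by (rule linearI) (simp_all add: inner_add_left algebra_simps sum.distrib scaleR_sum_right)
    show "norm (x - (\<Sum>n<N. (x \<bullet> e n) *\<^sub>R e n)) \<le> 1 * norm x" for x
      by (rule power2_le_imp_le) (use bessel_pythagoras[of x N] in simp_all)
  next
    fix g assume "g \<in> range e"
    then obtain j where g: "g = e j" by blast
    have "e j - (\<Sum>n<N. (e j \<bullet> e n) *\<^sub>R e n) = 0" if "N > j" for N
    proof -
      have "(\<Sum>n<N. (e j \<bullet> e n) *\<^sub>R e n) = (\<Sum>n<N. if n = j then (e j \<bullet> e j) *\<^sub>R e j else 0)"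
        by (rule sum.cong) (auto simp: inner_basis_seq)
      also have "\<dots> = (e j \<bullet> e j) *\<^sub>R e j" using that by simp
      also have "\<dots> = e j" using inner_basis_seq_self[of "e j" j] by (cases "e j = 0") auto
      finally show ?thesis by simp
    qed
    then show "\<forall>\<^sub>F N in sequentially. g - (\<Sum>n<N. (g \<bullet> e n) *\<^sub>R e n) = 0"
      unfolding g eventually_sequentially by (metis Suc_le_lessD)
  qed (rule total_basis_seq)
  from tendsto_diff[OF tendsto_const this, of x] show ?thesis by (simp add: sums_def)
qed

lemma parseval: "(\<lambda>n. (x \<bullet> e n) * (y \<bullet> e n)) sums (x \<bullet> y)"
  using bounded_linear.sums[OF bounded_linear_inner_left basis_seq_expansion, of x y]
  by (simp add: inner_commute)

lemma parseval_norm: "(\<lambda>n. (x \<bullet> e n)\<^sup>2) sums (norm x)\<^sup>2"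
  using parseval[of x x] unfolding power2_norm_eq_inner power2_eq_square[of "_ \<bullet> _"] .

lemma partial_parseval_le: "(\<Sum>n<N. (x \<bullet> e n) * (y \<bullet> e n)) \<le> norm x * norm y"
proof -
  have "(\<Sum>n<N. (x \<bullet> e n) * (y \<bullet> e n)) = (\<Sum>n<N. (x \<bullet> e n) *\<^sub>R e n) \<bullet> y"
    by (simp add: inner_sum_left inner_commute[of y])
  also have "\<dots> \<le> norm (\<Sum>n<N. (x \<bullet> e n) *\<^sub>R e n) * norm y" by (rule norm_cauchy_schwarz)
  also have "\<dots> \<le> norm x * norm y"
    by (intro mult_right_mono, rule power2_le_imp_le) (use bessel_pythagoras[of x N] in simp_all)
  finally show ?thesis .
qed

end

section \<open>Trace, nuclear norm and Hilbert-Schmidt norm of positive operators\<close>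

definition positive_op :: "('a::real_inner \<Rightarrow> 'a) \<Rightarrow> bool" where
  "positive_op A \<longleftrightarrow> linear A \<and> self_adjoint_op A \<and> nonneg_op A"

text \<open>
  The quadratic polynomial \<open>t \<mapsto> \<langle>A (x + t y), x + t y\<rangle>\<close> is nonnegative; evaluate it at its
  minimizer. When \<open>\<langle>A y, y\<rangle> = 0\<close> it is affine and would take the value \<open>-1\<close> if its slope were
  not zero.
\<close>
lemma positive_op_cauchy_schwarz:
  assumes A: "positive_op A"
  shows "(A x \<bullet> y)\<^sup>2 \<le> (A x \<bullet> x) * (A y \<bullet> y)"
proof -
  have lin: "linear A" and sym: "A y \<bullet> x = A x \<bullet> y" and pos: "0 \<le> A z \<bullet> z" for z
    using A by (auto simp: positive_op_def self_adjoint_op_def nonneg_op_def) (metis inner_commute)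
  have quad: "0 \<le> A x \<bullet> x + 2 * t * (A x \<bullet> y) + t\<^sup>2 * (A y \<bullet> y)" for t
    using pos[of "x + t *\<^sub>R y"]
    by (simp add: linear_add[OF lin] linear_scale[OF lin] inner_add_left inner_add_right sym
        power2_eq_square algebra_simps)
  show ?thesis
  proof (cases "A y \<bullet> y = 0")
    case False
    then have "A y \<bullet> y > 0" using pos[of y] by simp
    with quad[of "- (A x \<bullet> y) / (A y \<bullet> y)"] show ?thesis
      by (simp add: power2_eq_square field_simps)
  next
    case True
    have "A x \<bullet> y = 0"
    proof (rule ccontr)
      assume "A x \<bullet> y \<noteq> 0"
      with quad[of "- (A x \<bullet> x + 1) / (2 * (A x \<bullet> y))"] True show False by (simp add: field_simps)
    qed
    then show ?thesis using True by simp
  qed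
qed

lemma positive_op_eq_0:
  assumes A: "positive_op A" and "A y \<bullet> y = 0"
  shows "A y = 0"
  using positive_op_cauchy_schwarz[OF A, of y "A y"] assms(2) by simp

text \<open>
  For an arbitrary nuclear representation the partial traces are sums over \<open>n\<close> of partial
  Parseval sums of \<open>a n\<close> against \<open>b n\<close>; Cauchy-Schwarz for each \<open>n\<close> avoids any exchange of
  infinite sums.
\<close>
lemma trace_le_nuclear_representation:
  assumes e: "basis_seq e" and tr: "(\<lambda>m. A (e m) \<bullet> e m) sums t"
    and rep: "nuclear_representation A a b"
  shows "t \<le> (\<Sum>n. norm (a n) * norm (b n))"
proof -
  have summ: "summable (\<lambda>n. norm (a n) * norm (b n))"
    and sums: "\<And>x. (\<lambda>n. (a n \<bullet> x) *\<^sub>R b n) sums A x"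
    using rep by (auto simp: nuclear_representation_def)
  have "(\<Sum>m<M. A (e m) \<bullet> e m) \<le> (\<Sum>n. norm (a n) * norm (b n))" for M
  proof (rule sums_le)
    have "(\<lambda>n. (a n \<bullet> e m) * (b n \<bullet> e m)) sums (A (e m) \<bullet> e m)" for m
      using bounded_linear.sums[OF bounded_linear_inner_left sums] by simp
    then show "(\<lambda>n. \<Sum>m<M. (a n \<bullet> e m) * (b n \<bullet> e m)) sums (\<Sum>m<M. A (e m) \<bullet> e m)"
      by (intro sums_sum)
    show "(\<Sum>m<M. (a n \<bullet> e m) * (b n \<bullet> e m)) \<le> norm (a n) * norm (b n)" for n
      by (rule partial_parseval_le[OF e])
    show "(\<lambda>n. norm (a n) * norm (b n)) sums (\<Sum>n. norm (a n) * norm (b n))"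
      using summ by (rule summable_sums)
  qed
  then show ?thesis using tr unfolding sums_def by (intro LIMSEQ_le_const2) auto
qed

text \<open>
  One step of pivoted Cholesky elimination: the rank-one operator that agrees with the current
  remainder at the \<open>n\<close>-th basis vector is split off. When the pivot \<open>\<langle>A e\<^sub>n, e\<^sub>n\<rangle>\<close> vanishes,
  so does \<open>A e\<^sub>n\<close>, and the division by zero yields the desired value.
\<close>
primrec cholesky_remainder :: "(nat \<Rightarrow> 'a::real_inner) \<Rightarrow> ('a \<Rightarrow> 'a) \<Rightarrow> nat \<Rightarrow> 'a \<Rightarrow> 'a" where
  "cholesky_remainder e K 0 = K"
| "cholesky_remainder e K (Suc n) = (\<lambda>x. cholesky_remainder e K n x
     - ((cholesky_remainder e K n (e n) \<bullet> x) / (cholesky_remainder e K n (e n) \<bullet> e n))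
       *\<^sub>R cholesky_remainder e K n (e n))"

definition cholesky_vector :: "(nat \<Rightarrow> 'a::real_inner) \<Rightarrow> ('a \<Rightarrow> 'a) \<Rightarrow> nat \<Rightarrow> 'a" where
  "cholesky_vector e K n =
     cholesky_remainder e K n (e n) /\<^sub>R sqrt (cholesky_remainder e K n (e n) \<bullet> e n)"

lemma cholesky_remainder_step:
  fixes A :: "'a::real_inner \<Rightarrow> 'a" and v w :: 'a
  assumes A: "positive_op A"
  defines "A' \<equiv> \<lambda>x. A x - ((A v \<bullet> x) / (A v \<bullet> v)) *\<^sub>R A v"
  shows "positive_op A'" and "A' v = 0" and "A w = 0 \<Longrightarrow> A' w = 0"
proof -
  have lin: "linear A" and sym: "\<And>x y. A x \<bullet> y = x \<bullet> A y" and pos: "\<And>z. 0 \<le> A z \<bullet> z"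
    using A by (auto simp: positive_op_def self_adjoint_op_def nonneg_op_def)
  have "linear A'" unfolding A'_def
    by (rule linearI)
       (simp_all add: linear_add[OF lin] linear_scale[OF lin] inner_add_right add_divide_distrib algebra_simps)
  moreover have "self_adjoint_op A'" unfolding self_adjoint_op_def A'_def
  proof (intro allI)
    fix x y
    show "(A x - ((A v \<bullet> x) / (A v \<bullet> v)) *\<^sub>R A v) \<bullet> y = x \<bullet> (A y - ((A v \<bullet> y) / (A v \<bullet> v)) *\<^sub>R A v)"
      unfolding inner_diff_left inner_diff_right inner_scaleR_left inner_scaleR_right
        inner_commute[of x "A v"] sym[of x y] by simp
  qed
  moreover have "nonneg_op A'" unfolding nonneg_op_def
  proof
    fix x
    have "(A v \<bullet> x) * (A v \<bullet> x) / (A v \<bullet> v) \<le> A x \<bullet> x"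
    proof (cases "A v \<bullet> v = 0")
      case False
      then have "A v \<bullet> v > 0" using pos[of v] by simp
      then show ?thesis using positive_op_cauchy_schwarz[OF A, of v x]
        by (simp add: pos_divide_le_eq power2_eq_square mult.commute)
    qed (simp add: pos)
    then show "0 \<le> A' x \<bullet> x" by (simp add: A'_def inner_diff_left)
  qed
  ultimately show "positive_op A'" by (simp add: positive_op_def)
  show "A' v = 0"
    using positive_op_eq_0[OF A, of v] by (cases "A v \<bullet> v = 0") (auto simp: A'_def)
  show "A' w = 0" if "A w = 0" using that sym[of v w] by (simp add: A'_def)
qed

context
  fixes e :: "nat \<Rightarrow> 'a::real_inner" and K :: "'a \<Rightarrow> 'a"
  assumes K: "positive_op K"
begin

lemma positive_cholesky_remainder: "positive_op (cholesky_remainder e K n)"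
proof (induction n)
  case (Suc n)
  then show ?case using cholesky_remainder_step(1)[OF Suc, of "e n"] by simp
qed (simp add: K)

lemma cholesky_remainder_vanishes: "j < n \<Longrightarrow> cholesky_remainder e K n (e j) = 0"
proof (induction n)
  case (Suc n)
  show ?case
  proof (cases "j = n")
    case True
    then show ?thesis
      using cholesky_remainder_step(2)[OF positive_cholesky_remainder, of n "e n"] by simp
  next
    case False
    then have "cholesky_remainder e K n (e j) = 0" using Suc by simp
    from cholesky_remainder_step(3)[OF positive_cholesky_remainder this] show ?thesis by simp
  qed
qed simp

lemma cholesky_decomposition:
  "K x = (\<Sum>n<N. (cholesky_vector e K n \<bullet> x) *\<^sub>R cholesky_vector e K n) + cholesky_remainder e K N x"
proof (induction N)
  case (Suc N)
  have "cholesky_remainder e K N (e N) \<bullet> e N \<ge> 0"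
    using positive_cholesky_remainder[of N] by (simp add: positive_op_def nonneg_op_def)
  then have "(cholesky_vector e K N \<bullet> x) *\<^sub>R cholesky_vector e K N =
      ((cholesky_remainder e K N (e N) \<bullet> x) / (cholesky_remainder e K N (e N) \<bullet> e N))
       *\<^sub>R cholesky_remainder e K N (e N)"
    by (simp add: cholesky_vector_def divide_inverse flip: inverse_mult_distrib)
  then show ?case using Suc by simp
qed simp

lemma cholesky_quadratic_form:
  "(\<Sum>n<N. (cholesky_vector e K n \<bullet> x)\<^sup>2) \<le> K x \<bullet> x"
  and cholesky_remainder_le: "cholesky_remainder e K N x \<bullet> x \<le> K x \<bullet> x"
proof -
  have "K x \<bullet> x = (\<Sum>n<N. (cholesky_vector e K n \<bullet> x)\<^sup>2) + cholesky_remainder e K N x \<bullet> x"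
    by (subst cholesky_decomposition[of x N])
       (simp add: inner_add_left inner_sum_left power2_eq_square)
  moreover have "0 \<le> cholesky_remainder e K N x \<bullet> x"
    using positive_cholesky_remainder[of N] by (simp add: positive_op_def nonneg_op_def)
  moreover have "0 \<le> (\<Sum>n<N. (cholesky_vector e K n \<bullet> x)\<^sup>2)" by (simp add: sum_nonneg)
  ultimately show "(\<Sum>n<N. (cholesky_vector e K n \<bullet> x)\<^sup>2) \<le> K x \<bullet> x"
    "cholesky_remainder e K N x \<bullet> x \<le> K x \<bullet> x" by linarith+
qed

text \<open>
  The remainders are dominated by \<open>K\<close> as quadratic forms, hence uniformly bounded, and they
  eventually annihilate each basis vector.
\<close>
lemma cholesky_remainder_tendsto_0:
  assumes bl: "bounded_linear K" and e: "basis_seq e"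
  shows "(\<lambda>N. cholesky_remainder e K N x) \<longlonglongrightarrow> 0"
proof -
  obtain C where C0: "C > 0" and C: "\<And>x. norm (K x) \<le> norm x * C"
    using bounded_linear.pos_bounded[OF bl] by blast
  have form_le: "K x \<bullet> x \<le> C * (norm x)\<^sup>2" for x
  proof -
    have "K x \<bullet> x \<le> norm (K x) * norm x" by (rule norm_cauchy_schwarz)
    also have "\<dots> \<le> norm x * C * norm x" by (intro mult_right_mono C) simp
    finally show ?thesis by (simp add: power2_eq_square mult_ac)
  qed
  show ?thesis
  proof (rule tendsto_zero_on_total_set[where C = C and G = "range e"])
    fix N
    let ?R = "cholesky_remainder e K N"
    show "linear ?R" using positive_cholesky_remainder by (simp add: positive_op_def)
    show "norm (?R x) \<le> C * norm x" for x
    proof (cases "?R x = 0")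
      case False
      have "(norm (?R x))\<^sup>2 * (norm (?R x))\<^sup>2 = (?R x \<bullet> ?R x)\<^sup>2"
        unfolding power2_norm_eq_inner by (rule power2_eq_square[symmetric])
      also have "\<dots> \<le> (?R x \<bullet> x) * (?R (?R x) \<bullet> ?R x)"
        by (rule positive_op_cauchy_schwarz[OF positive_cholesky_remainder])
      also have "\<dots> \<le> (C * (norm x)\<^sup>2) * (C * (norm (?R x))\<^sup>2)"
      proof (rule mult_mono)
        show "?R x \<bullet> x \<le> C * (norm x)\<^sup>2" "?R (?R x) \<bullet> ?R x \<le> C * (norm (?R x))\<^sup>2"
          by (rule order.trans[OF cholesky_remainder_le form_le])+
        show "0 \<le> ?R (?R x) \<bullet> ?R x"
          using positive_cholesky_remainder[of N] by (simp add: positive_op_def nonneg_op_def)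
      qed (use C0 in simp)
      finally have "(norm (?R x))\<^sup>2 * (norm (?R x))\<^sup>2 \<le> (C * norm x)\<^sup>2 * (norm (?R x))\<^sup>2"
        by (simp add: power2_eq_square mult_ac)
      then have "(norm (?R x))\<^sup>2 \<le> (C * norm x)\<^sup>2"
        by (rule mult_right_le_imp_le) (simp add: False)
      then show ?thesis by (rule power2_le_imp_le) (use C0 in simp)
    qed (use C0 in simp)
  next
    fix g assume "g \<in> range e"
    then obtain j where g: "g = e j" by blast
    show "\<forall>\<^sub>F n in sequentially. cholesky_remainder e K n g = 0"
      unfolding g using eventually_gt_at_top[of j]
      by (rule eventually_mono) (rule cholesky_remainder_vanishes)
  qed (rule total_basis_seq[OF e])
qed

text \<open>
  The Cholesky vectors give a nuclear representation whose size is at most the trace: by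
  Parseval the partial sums of \<open>\<parallel>c\<^sub>n\<parallel>\<^sup>2\<close> are traces of operators dominated by \<open>K\<close>.
\<close>
lemma cholesky_nuclear_representation:
  assumes bl: "bounded_linear K" and e: "basis_seq e" and tr: "(\<lambda>m. K (e m) \<bullet> e m) sums t"
  defines "c \<equiv> cholesky_vector e K"
  shows "nuclear_representation K c c" and "(\<Sum>n. norm (c n) * norm (c n)) \<le> t"
proof -
  have partial: "(\<Sum>n<N. norm (c n) * norm (c n)) \<le> t" for N
  proof (rule sums_le)
    show "(\<lambda>m. \<Sum>n<N. (c n \<bullet> e m)\<^sup>2) sums (\<Sum>n<N. norm (c n) * norm (c n))"
      using parseval_norm[OF e] by (intro sums_sum) (simp add: power2_eq_square)
    show "(\<Sum>n<N. (c n \<bullet> e m)\<^sup>2) \<le> K (e m) \<bullet> e m" for m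
      unfolding c_def by (rule cholesky_quadratic_form)
  qed (rule tr)
  then have summ: "summable (\<lambda>n. norm (c n) * norm (c n))"
    by (intro summableI_nonneg_bounded[of _ t]) auto
  then show "(\<Sum>n. norm (c n) * norm (c n)) \<le> t"
    using partial by (intro suminf_le_const) auto
  have "(\<lambda>n. (c n \<bullet> x) *\<^sub>R c n) sums K x" for x
  proof -
    have "(\<lambda>N. K x - cholesky_remainder e K N x) \<longlonglongrightarrow> K x"
      using tendsto_diff[OF tendsto_const cholesky_remainder_tendsto_0[OF bl e], of "K x" x] by simp
    moreover have "K x - cholesky_remainder e K N x = (\<Sum>n<N. (c n \<bullet> x) *\<^sub>R c n)" for N
      using cholesky_decomposition[of x N] by (simp add: c_def)
    ultimately show ?thesis by (simp add: sums_def)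
  qed
  with summ show "nuclear_representation K c c" by (simp add: nuclear_representation_def)
qed

text \<open>The Cholesky representation attains the lower bound that every representation obeys.\<close>
lemma nuclear_norm_positive_op:
  assumes bl: "bounded_linear K" and e: "basis_seq e" and tr: "(\<lambda>m. K (e m) \<bullet> e m) sums t"
  shows "nuclear_norm K = t"
proof (rule antisym)
  let ?S = "{(\<Sum>n. norm (a n) * norm (b n)) | a b. nuclear_representation K a b}"
  have lower: "t \<le> s" if "s \<in> ?S" for s
    using that trace_le_nuclear_representation[OF e tr] by blast
  note chol = cholesky_nuclear_representation[OF bl e tr]
  have mem: "(\<Sum>n. norm (cholesky_vector e K n) * norm (cholesky_vector e K n)) \<in> ?S"
    using chol(1) by blast
  have "nuclear_norm K \<le> (\<Sum>n. norm (cholesky_vector e K n) * norm (cholesky_vector e K n))"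
    unfolding nuclear_norm_def by (rule cInf_lower[OF mem]) (rule bdd_belowI[OF lower])
  also have "\<dots> \<le> t" by (rule chol(2))
  finally show "nuclear_norm K \<le> t" .
  show "t \<le> nuclear_norm K"
    unfolding nuclear_norm_def by (rule cInf_greatest) (use mem lower in blast)+
qed

text \<open>
  Cauchy-Schwarz for the form of \<open>K\<close> bounds the squared matrix entries by products of diagonal
  entries, so the Hilbert-Schmidt norm is at most the trace.
\<close>
lemma hilbert_schmidt_le_trace:
  assumes e: "basis_seq e" and tr: "(\<lambda>m. K (e m) \<bullet> e m) sums t"
  shows "summable (\<lambda>n. (norm (K (e n)))\<^sup>2)" and "(\<Sum>n. (norm (K (e n)))\<^sup>2) \<le> t\<^sup>2"
proof -
  have le: "(norm (K (e n)))\<^sup>2 \<le> (K (e n) \<bullet> e n) * t" for n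
  proof (rule sums_le)
    show "(\<lambda>m. (K (e n) \<bullet> e m)\<^sup>2) sums (norm (K (e n)))\<^sup>2" by (rule parseval_norm[OF e])
    show "(\<lambda>m. (K (e n) \<bullet> e n) * (K (e m) \<bullet> e m)) sums ((K (e n) \<bullet> e n) * t)"
      by (rule sums_mult[OF tr])
    show "(K (e n) \<bullet> e m)\<^sup>2 \<le> (K (e n) \<bullet> e n) * (K (e m) \<bullet> e m)" for m
      by (rule positive_op_cauchy_schwarz[OF K])
  qed
  have s: "(\<lambda>n. (K (e n) \<bullet> e n) * t) sums t\<^sup>2"
    using sums_mult2[OF tr, of t] by (simp add: power2_eq_square)
  show summ: "summable (\<lambda>n. (norm (K (e n)))\<^sup>2)"
    by (rule summable_comparison_test'[OF sums_summable[OF s], of 0]) (use le in auto)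
  show "(\<Sum>n. (norm (K (e n)))\<^sup>2) \<le> t\<^sup>2"
    by (rule sums_le[OF le summable_sums[OF summ] s])
qed

end

section \<open>Moments of Gaussian measures\<close>

text \<open>
  The characteristic function is known for the standard normal law and is transported along the
  affine map.
\<close>
lemma normal_law_eq_distr_std_normal:
  assumes "v > 0"
  shows "normal_law m v = distr std_normal_distribution borel (\<lambda>x. m + sqrt v * x)"
proof -
  interpret N: prob_space std_normal_distribution by (rule prob_space_normal_density) simp
  have "distributed std_normal_distribution lborel (\<lambda>x. x) std_normal_density"
    by (simp add: distributed_def distr_id2)
  from N.normal_density_affine[OF this, of "sqrt v" m] assms
  have "distributed std_normal_distribution lborel (\<lambda>x. m + sqrt v * x) (normal_density m (sqrt v))"
    by simp
  from distributed_distr_eq_density[OF this] show ?thesis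
    using assms by (simp add: normal_law_def cong: distr_cong)
qed

lemma char_normal_law:
  assumes "v \<ge> 0"
  shows "char (normal_law m v) t = iexp (t * m) * complex_of_real (exp (- (v * t\<^sup>2 / 2)))"
proof (cases "v = 0")
  case True
  then show ?thesis by (simp add: normal_law_def char_def integral_return)
next
  case False
  with assms have v: "v > 0" by simp
  have "char (normal_law m v) t = (CLINT x|std_normal_distribution. iexp (t * m) * iexp ((t * sqrt v) * x))"
    unfolding normal_law_eq_distr_std_normal[OF v] char_def
    by (subst integral_distr) (simp_all add: algebra_simps flip: exp_add)
  also have "\<dots> = iexp (t * m) * char std_normal_distribution (t * sqrt v)"
    unfolding char_def by (rule integral_mult_right_zero)
  also have "\<dots> = iexp (t * m) * complex_of_real (exp (- (v * t\<^sup>2 / 2)))"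
    using v by (simp add: char_std_normal_distribution power_mult_distrib mult.commute)
  finally show ?thesis .
qed

lemma normal_law_even_moment:
  assumes "v \<ge> 0" and k: "k > 0"
  shows "has_bochner_integral (normal_law 0 v) (\<lambda>x. x ^ (2 * k)) (fact (2 * k) / (2 ^ k * fact k) * v ^ k)"
proof (cases "v = 0")
  case True
  have "integrable (return borel (0::real)) (\<lambda>x. x ^ (2 * k))"
    by (rule integrableI_bounded) (simp_all add: nn_integral_return)
  with True k show ?thesis
    by (simp add: normal_law_def has_bochner_integral_iff integral_return power_0_left)
next
  case False
  with assms have v: "v > 0" by simp
  have "has_bochner_integral lborel (\<lambda>x. normal_density 0 (sqrt v) x * x ^ (2 * k))
    (fact (2 * k) / ((2 / (sqrt v)\<^sup>2) ^ k * fact k))"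
    using normal_moment_even[of "sqrt v" 0 k] v by simp
  then show ?thesis
    using v by (simp add: normal_law_def has_bochner_integral_iff integrable_density integral_density power_divide)
qed

context
  fixes M :: "'a::{real_inner, polish_space} measure" and m :: 'a and C :: "'a \<Rightarrow> 'a"
  assumes gauss: "gaussian_measure M m C" and C: "positive_op C"
begin

lemma measurable_gaussian: "f \<in> borel_measurable borel \<Longrightarrow> f \<in> borel_measurable M"
  using gauss by (metis gaussian_measure_def measurable_cong_sets)

lemma gaussian_characteristic_functional:
  "(CLINT y|M. iexp (b \<bullet> y)) = iexp (b \<bullet> m) * complex_of_real (exp (- (C b \<bullet> b / 2)))"
proof -
  have d: "distr M borel (\<lambda>y. b \<bullet> y) = normal_law (b \<bullet> m) (C b \<bullet> b)"
    using gauss by (simp add: gaussian_measure_def)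
  have "(CLINT y|M. iexp (b \<bullet> y)) = char (distr M borel (\<lambda>y. b \<bullet> y)) 1"
    unfolding char_def by (subst integral_distr) (auto intro!: measurable_gaussian)
  also have "\<dots> = iexp (b \<bullet> m) * complex_of_real (exp (- (C b \<bullet> b / 2)))"
    unfolding d using C by (subst char_normal_law) (auto simp: positive_op_def nonneg_op_def)
  finally show ?thesis .
qed

lemma gaussian_even_moment:
  assumes "b \<bullet> m = 0" and "k > 0"
  shows "has_bochner_integral M (\<lambda>y. (b \<bullet> y) ^ (2 * k)) (fact (2 * k) / (2 ^ k * fact k) * (C b \<bullet> b) ^ k)"
proof -
  have d: "distr M borel (\<lambda>y. b \<bullet> y) = normal_law 0 (C b \<bullet> b)"
    using gauss assms by (simp add: gaussian_measure_def)
  have "C b \<bullet> b \<ge> 0" using C by (simp add: positive_op_def nonneg_op_def)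
  from normal_law_even_moment[OF this \<open>k > 0\<close>, folded d] show ?thesis
    by (simp add: has_bochner_integral_iff integrable_distr_eq integral_distr measurable_gaussian)
qed

text \<open>
  Isserlis' formula for two squares, by polarization: \<open>12 x\<^sup>2y\<^sup>2 = (x+y)\<^sup>4 + (x-y)\<^sup>4 - 2x\<^sup>4 - 2y\<^sup>4\<close>,
  and each fourth moment on the right is three times a squared variance.
\<close>
lemma gaussian_product_moment:
  assumes bm: "b \<bullet> m = 0" and cm: "c \<bullet> m = 0"
  shows "has_bochner_integral M (\<lambda>y. (b \<bullet> y)\<^sup>2 * (c \<bullet> y)\<^sup>2)
    ((C b \<bullet> b) * (C c \<bullet> c) + 2 * (C b \<bullet> c)\<^sup>2)"
proof -
  have lin: "linear C" and sym: "C c \<bullet> b = C b \<bullet> c"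
    using C by (auto simp: positive_op_def self_adjoint_op_def) (metis inner_commute)
  have four: "has_bochner_integral M (\<lambda>y. (d \<bullet> y) ^ 4) (3 * (C d \<bullet> d)\<^sup>2)" if "d \<bullet> m = 0" for d
    using gaussian_even_moment[OF that, of 2] by (simp add: fact_numeral)
  have poly: "has_bochner_integral M
      (\<lambda>y. (((b + c) \<bullet> y) ^ 4 + ((b - c) \<bullet> y) ^ 4 - 2 * (b \<bullet> y) ^ 4 - 2 * (c \<bullet> y) ^ 4) / 12)
      ((3 * (C (b + c) \<bullet> (b + c))\<^sup>2 + 3 * (C (b - c) \<bullet> (b - c))\<^sup>2
        - 2 * (3 * (C b \<bullet> b)\<^sup>2) - 2 * (3 * (C c \<bullet> c)\<^sup>2)) / 12)"
    using bm cm
    by (intro has_bochner_integral_divide_zero has_bochner_integral_diff has_bochner_integral_add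
        has_bochner_integral_mult_right four) (simp_all add: inner_add_left inner_diff_left)
  have square: "(((b + c) \<bullet> y) ^ 4 + ((b - c) \<bullet> y) ^ 4 - 2 * (b \<bullet> y) ^ 4 - 2 * (c \<bullet> y) ^ 4) / 12
      = (b \<bullet> y)\<^sup>2 * (c \<bullet> y)\<^sup>2" for y
    unfolding inner_add_left inner_diff_left
    by (simp add: power4_eq_xxxx power2_eq_square algebra_simps)
  have variance: "(3 * (C (b + c) \<bullet> (b + c))\<^sup>2 + 3 * (C (b - c) \<bullet> (b - c))\<^sup>2
        - 2 * (3 * (C b \<bullet> b)\<^sup>2) - 2 * (3 * (C c \<bullet> c)\<^sup>2)) / 12
      = (C b \<bullet> b) * (C c \<bullet> c) + 2 * (C b \<bullet> c)\<^sup>2"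
    unfolding linear_add[OF lin] linear_diff[OF lin] inner_add_left inner_diff_left
      inner_add_right inner_diff_right sym
    by (simp add: power2_eq_square algebra_simps)
  show ?thesis using poly unfolding square variance .
qed

text \<open>
  The squared norm of the image under \<open>T\<close> is the sum of the squares of its coordinates
  \<open>\<langle>T y, e\<^sub>n\<rangle> = \<langle>T\<^sup>* e\<^sub>n, y\<rangle>\<close>, whose covariances are the matrix entries of \<open>T C T\<^sup>*\<close>. All terms are
  nonnegative, so expectation and summation commute.
\<close>
lemma gaussian_norm_moments:
  fixes T :: "'a \<Rightarrow> 'b::{real_inner, second_countable_topology}"
  assumes T: "bounded_linear T" and Tm: "T m = 0" and e: "basis_seq e"
    and K: "K = T \<circ> C \<circ> adjoint T"
    and tr: "(\<lambda>n. K (e n) \<bullet> e n) sums t" and hs: "(\<lambda>n. (norm (K (e n)))\<^sup>2) sums h"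
  shows "has_bochner_integral M (\<lambda>y. (norm (T y))\<^sup>2) t"
    and "has_bochner_integral M (\<lambda>y. (norm (T y)) ^ 4) (t\<^sup>2 + 2 * h)"
proof -
  define X where "X n y = (T y \<bullet> e n)\<^sup>2" for n y
  have X_adj: "X n y = (adjoint T (e n) \<bullet> y)\<^sup>2" for n y
    by (simp add: X_def inner_adjoint[OF T] inner_commute)
  have centred: "adjoint T (e n) \<bullet> m = 0" for n
    using inner_adjoint[OF T, of m "e n"] Tm by (simp add: inner_commute)
  have cov: "C (adjoint T (e n)) \<bullet> adjoint T (e k) = K (e n) \<bullet> e k" for n k
    by (simp add: K inner_adjoint[OF T])
  have X_nonneg: "0 \<le> X n y" for n y by (simp add: X_def)
  have K_nonneg: "0 \<le> K (e n) \<bullet> e n" for n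
    using C by (simp add: positive_op_def nonneg_op_def flip: cov)
  have [measurable]: "X n \<in> borel_measurable M" for n
    unfolding X_adj[abs_def] by (rule measurable_gaussian) simp
  have T_meas: "(\<lambda>y. (norm (T y)) ^ k) \<in> borel_measurable M" for k
    by (intro measurable_gaussian borel_measurable_continuous_onI continuous_intros
        bounded_linear.continuous_on[OF T])
  have EX: "(\<integral>\<^sup>+y. ennreal (X n y) \<partial>M) = ennreal (K (e n) \<bullet> e n)" for n
  proof -
    have "has_bochner_integral M (X n) (K (e n) \<bullet> e n)"
      using gaussian_even_moment[OF centred, of 1 n] by (simp add: X_adj[abs_def] cov)
    then show ?thesis
      by (subst nn_integral_eq_integral) (auto simp: has_bochner_integral_iff X_nonneg)
  qed
  have EXX: "(\<integral>\<^sup>+y. ennreal (X n y * X k y) \<partial>M)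
      = ennreal ((K (e n) \<bullet> e n) * (K (e k) \<bullet> e k) + 2 * (K (e n) \<bullet> e k)\<^sup>2)" for n k
  proof -
    have "has_bochner_integral M (\<lambda>y. X n y * X k y)
        ((K (e n) \<bullet> e n) * (K (e k) \<bullet> e k) + 2 * (K (e n) \<bullet> e k)\<^sup>2)"
      using gaussian_product_moment[OF centred centred, of n k] by (simp add: X_adj cov)
    then show ?thesis
      by (subst nn_integral_eq_integral) (auto simp: has_bochner_integral_iff X_nonneg)
  qed
  have sumX: "(\<lambda>n. X n y) sums (norm (T y))\<^sup>2" for y
    unfolding X_def by (rule parseval_norm[OF e])
  have t: "0 \<le> t" using K_nonneg by (intro sums_le[OF _ sums_zero tr])
  have h: "0 \<le> h" by (intro sums_le[OF _ sums_zero hs]) simp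
  have "(\<integral>\<^sup>+y. ennreal ((norm (T y))\<^sup>2) \<partial>M) = (\<integral>\<^sup>+y. (\<Sum>n. ennreal (X n y)) \<partial>M)"
    by (intro nn_integral_cong suminf_ennreal_eq[OF X_nonneg sumX, symmetric])
  also have "\<dots> = (\<Sum>n. ennreal (K (e n) \<bullet> e n))" by (simp add: nn_integral_suminf EX)
  also have "\<dots> = ennreal t" by (rule suminf_ennreal_eq[OF K_nonneg tr])
  finally show "has_bochner_integral M (\<lambda>y. (norm (T y))\<^sup>2) t"
    by (intro has_bochner_integral_nn_integral t T_meas) auto
  have rowX: "(\<lambda>k. X n y * X k y) sums (X n y * (norm (T y))\<^sup>2)" for n y
    by (rule sums_mult[OF sumX])
  have sumXX: "(\<lambda>n. X n y * (norm (T y))\<^sup>2) sums (norm (T y)) ^ 4" for y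
    using sums_mult2[OF sumX, of y "(norm (T y))\<^sup>2"] by (simp flip: power_add)
  have rowK: "(\<lambda>k. (K (e n) \<bullet> e n) * (K (e k) \<bullet> e k) + 2 * (K (e n) \<bullet> e k)\<^sup>2)
      sums ((K (e n) \<bullet> e n) * t + 2 * (norm (K (e n)))\<^sup>2)" for n
    by (intro sums_add sums_mult tr parseval_norm[OF e])
  have sumKK: "(\<lambda>n. (K (e n) \<bullet> e n) * t + 2 * (norm (K (e n)))\<^sup>2) sums (t\<^sup>2 + 2 * h)"
    unfolding power2_eq_square[of t] by (intro sums_add sums_mult sums_mult2 tr hs)
  have "(\<integral>\<^sup>+y. ennreal ((norm (T y)) ^ 4) \<partial>M) = (\<integral>\<^sup>+y. (\<Sum>n. \<Sum>k. ennreal (X n y * X k y)) \<partial>M)"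
  proof (rule nn_integral_cong)
    fix y
    have "(\<Sum>n. \<Sum>k. ennreal (X n y * X k y)) = (\<Sum>n. ennreal (X n y * (norm (T y))\<^sup>2))"
      by (intro suminf_cong suminf_ennreal_eq[OF _ rowX]) (simp add: X_nonneg)
    also have "\<dots> = ennreal ((norm (T y)) ^ 4)"
      by (intro suminf_ennreal_eq[OF _ sumXX]) (simp add: X_nonneg)
    finally show "ennreal ((norm (T y)) ^ 4) = (\<Sum>n. \<Sum>k. ennreal (X n y * X k y))" ..
  qed
  also have "\<dots> = (\<Sum>n. \<Sum>k. ennreal ((K (e n) \<bullet> e n) * (K (e k) \<bullet> e k) + 2 * (K (e n) \<bullet> e k)\<^sup>2))"
    by (simp add: nn_integral_suminf EXX)
  also have "\<dots> = (\<Sum>n. ennreal ((K (e n) \<bullet> e n) * t + 2 * (norm (K (e n)))\<^sup>2))"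
    by (intro suminf_cong suminf_ennreal_eq[OF _ rowK]) (simp add: K_nonneg)
  also have "\<dots> = ennreal (t\<^sup>2 + 2 * h)"
    by (intro suminf_ennreal_eq[OF _ sumKK]) (simp add: K_nonneg t)
  finally show "has_bochner_integral M (\<lambda>y. (norm (T y)) ^ 4) (t\<^sup>2 + 2 * h)"
    by (intro has_bochner_integral_nn_integral T_meas) (auto simp: t h)
qed

end

section \<open>Fourier uniqueness and independence\<close>

text \<open>
  The two measures obtained by weighting with the positive and the negative part of \<open>D\<close> have
  equal mass, and after normalization their images under \<open>B\<close> have the same characteristic
  function; so they agree by Levy's uniqueness theorem.
\<close>
lemma (in prob_space) fourier_null_imp_null_real:
  fixes D B :: "'a \<Rightarrow> real"
  assumes B[measurable]: "B \<in> borel_measurable M" and D: "integrable M D"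
    and null: "\<And>t. (CLINT x|M. iexp (t * B x) * complex_of_real (D x)) = 0"
    and F[measurable]: "F \<in> sets borel"
  shows "(LINT x|M. indicator F (B x) * D x) = 0"
proof -
  have Dm[measurable]: "D \<in> borel_measurable M" using D by simp
  define p where "p = (\<lambda>x. max 0 (D x))"
  define n where "n = (\<lambda>x. max 0 (- D x))"
  have p: "integrable M p" "\<And>x. 0 \<le> p x" and n: "integrable M n" "\<And>x. 0 \<le> n x"
    using D by (auto simp: p_def n_def)
  have Dpn: "D x = p x - n x" for x by (simp add: p_def n_def max_def)
  have int_iexp: "integrable M (\<lambda>x. iexp (t * B x) * complex_of_real (g x))"
    if "integrable M g" for t g
    by (rule Bochner_Integration.integrable_bound[OF that]) (use that in \<open>auto simp: norm_mult\<close>)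
  have int_ind: "integrable M (\<lambda>x. indicator F (B x) * g x)" if "integrable M g" for g :: "'a \<Rightarrow> real"
    by (rule Bochner_Integration.integrable_bound[OF that]) (use that in \<open>auto simp: indicator_def\<close>)
  have pn: "(CLINT x|M. iexp (t * B x) * complex_of_real (p x))
      = (CLINT x|M. iexp (t * B x) * complex_of_real (n x))" for t
  proof -
    have "0 = (CLINT x|M. iexp (t * B x) * complex_of_real (p x) - iexp (t * B x) * complex_of_real (n x))"
      using null[of t] by (simp only: Dpn of_real_diff right_diff_distrib)
    also have "\<dots> = (CLINT x|M. iexp (t * B x) * complex_of_real (p x))
        - (CLINT x|M. iexp (t * B x) * complex_of_real (n x))"
      by (intro Bochner_Integration.integral_diff int_iexp p n)
    finally show ?thesis by simp
  qed
  define r where "r = (LINT x|M. p x)"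
  have "complex_of_real (LINT x|M. p x) = complex_of_real (LINT x|M. n x)"
    using pn[of 0] by simp
  then have rn: "(LINT x|M. n x) = r" by (simp add: r_def)
  show ?thesis
  proof (cases "r = 0")
    case True
    then have "AE x in M. p x = 0" "AE x in M. n x = 0"
      using integral_nonneg_eq_0_iff_AE[OF p(1)] integral_nonneg_eq_0_iff_AE[OF n(1)] p(2) n(2) rn
      by (simp_all add: r_def[symmetric])
    then have "AE x in M. D x = 0" by eventually_elim (simp add: Dpn)
    then have "AE x in M. indicator F (B x) * D x = 0" by eventually_elim simp
    then show ?thesis by (rule integral_eq_zero_AE)
  next
    case False
    moreover have "r \<ge> 0" using p by (simp add: r_def)
    ultimately have r: "r > 0" by simp
    define law where "law g = distr (density M (\<lambda>x. ennreal (g x / r))) borel B" for g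
    have law: "real_distribution (law g)"
        "\<And>t. char (law g) t = (CLINT x|M. iexp (t * B x) * complex_of_real (g x)) / r"
        "measure (law g) F = (LINT x|M. indicator F (B x) * g x) / r"
      if g: "integrable M g" "\<And>x. 0 \<le> g x" "(LINT x|M. g x) = r" for g
    proof -
      have [measurable]: "g \<in> borel_measurable M" using g by simp
      have "(\<integral>\<^sup>+x. ennreal (g x / r) \<partial>M) = ennreal (LINT x|M. g x / r)"
        using g r by (intro nn_integral_eq_integral) auto
      also have "\<dots> = 1" using g(3) r by simp
      finally have "emeasure (density M (\<lambda>x. ennreal (g x / r))) (space M) = 1"
        by (subst emeasure_density) (simp_all cong: nn_integral_cong)
      then interpret N: prob_space "density M (\<lambda>x. ennreal (g x / r))"
        by (intro prob_spaceI) simp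
      show "real_distribution (law g)" unfolding law_def
        by (rule N.real_distribution_distr) simp
      show "char (law g) t = (CLINT x|M. iexp (t * B x) * complex_of_real (g x)) / r" for t
      proof -
        have "char (law g) t = (CLINT x|M. (g x / r) *\<^sub>R iexp (t * B x))"
          unfolding law_def char_def using g r
          by (subst integral_distr, simp, simp) (subst integral_density, simp_all)
        also have "\<dots> = (CLINT x|M. iexp (t * B x) * complex_of_real (g x) / r)"
          by (simp add: scaleR_conv_of_real mult.commute)
        finally show ?thesis by simp
      qed
      have "measure (law g) F = (LINT x|law g. indicator F x)" by (simp add: law_def)
      also have "\<dots> = (LINT x|M. (g x / r) *\<^sub>R indicator F (B x))"
        unfolding law_def using g r
        by (subst integral_distr, simp, simp) (subst integral_density, simp_all)
      also have "\<dots> = (LINT x|M. indicator F (B x) * g x / r)"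
        by (simp add: mult.commute)
      finally show "measure (law g) F = (LINT x|M. indicator F (B x) * g x) / r" by simp
    qed
    have "char (law p) = char (law n)"
      by (rule ext) (simp only: law(2)[OF p r_def[symmetric]] law(2)[OF n rn] pn)
    then have "law p = law n"
      by (intro Levy_uniqueness law p n rn r_def[symmetric])
    then have "(LINT x|M. indicator F (B x) * p x) = (LINT x|M. indicator F (B x) * n x)"
      using law(3)[OF p r_def[symmetric]] law(3)[OF n rn] r by simp
    then show ?thesis by (simp add: Dpn right_diff_distrib int_ind p n)
  qed
qed

text \<open>Conjugation turns \<open>t\<close> into \<open>-t\<close>, so the hypothesis passes to real and imaginary parts.\<close>
lemma (in prob_space) fourier_null_imp_null:
  fixes D :: "'a \<Rightarrow> complex"
  assumes B[measurable]: "B \<in> borel_measurable M" and D: "integrable M D"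
    and null: "\<And>t. (CLINT x|M. iexp (t * B x) * D x) = 0"
    and F: "F \<in> sets borel"
  shows "(CLINT x|M. indicator F (B x) * D x) = 0"
proof -
  have [measurable]: "D \<in> borel_measurable M" using D by simp
  have int_iexp: "integrable M (\<lambda>x. iexp (t * B x) * g x)"
    if "integrable M g" for t and g :: "'a \<Rightarrow> complex"
    by (rule Bochner_Integration.integrable_bound[OF that]) (use that in \<open>auto simp: norm_mult\<close>)
  have cnj_null: "(CLINT x|M. iexp (t * B x) * cnj (D x)) = 0" for t
  proof -
    have "(CLINT x|M. iexp (t * B x) * cnj (D x)) = cnj (CLINT x|M. iexp ((- t) * B x) * D x)"
      by (subst Bochner_Integration.integral_cnj[symmetric]) (simp add: exp_cnj)
    then show ?thesis by (simp only: null complex_cnj_zero)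
  qed
  have re: "(LINT x|M. indicator F (B x) * Re (D x)) = 0"
  proof (rule fourier_null_imp_null_real[OF B _ _ F])
    fix t
    have "(CLINT x|M. iexp (t * B x) * complex_of_real (Re (D x)))
        = (CLINT x|M. (iexp (t * B x) * D x + iexp (t * B x) * cnj (D x)) / 2)"
      by (rule Bochner_Integration.integral_cong) (auto simp: complex_add_cnj simp flip: distrib_left)
    also have "\<dots> = ((CLINT x|M. iexp (t * B x) * D x) + (CLINT x|M. iexp (t * B x) * cnj (D x))) / 2"
      using Bochner_Integration.integral_add[OF int_iexp[OF D] int_iexp[OF integrable_cnj[OF D]], of t t]
      by (simp only: integral_divide_zero)
    also have "\<dots> = 0" unfolding null cnj_null by simp
    finally show "(CLINT x|M. iexp (t * B x) * complex_of_real (Re (D x))) = 0" .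
  qed (use D in simp)
  have im: "(LINT x|M. indicator F (B x) * Im (D x)) = 0"
  proof (rule fourier_null_imp_null_real[OF B _ _ F])
    fix t
    have "(CLINT x|M. iexp (t * B x) * complex_of_real (Im (D x)))
        = (CLINT x|M. (iexp (t * B x) * D x - iexp (t * B x) * cnj (D x)) / (2 * \<i>))"
    proof (rule Bochner_Integration.integral_cong)
      fix x
      have eq: "iexp (t * B x) * D x - iexp (t * B x) * cnj (D x)
          = (iexp (t * B x) * complex_of_real (Im (D x))) * (2 * \<i>)"
        unfolding right_diff_distrib[symmetric] complex_diff_cnj by (simp add: mult_ac)
      show "iexp (t * B x) * complex_of_real (Im (D x))
          = (iexp (t * B x) * D x - iexp (t * B x) * cnj (D x)) / (2 * \<i>)"
        unfolding eq by (rule nonzero_mult_div_cancel_right[symmetric]) simp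
    qed simp
    also have "\<dots> = ((CLINT x|M. iexp (t * B x) * D x) - (CLINT x|M. iexp (t * B x) * cnj (D x))) / (2 * \<i>)"
      using Bochner_Integration.integral_diff[OF int_iexp[OF D] int_iexp[OF integrable_cnj[OF D]], of t t]
      by (simp only: integral_divide_zero)
    also have "\<dots> = 0" unfolding null cnj_null by simp
    finally show "(CLINT x|M. iexp (t * B x) * complex_of_real (Im (D x))) = 0" .
  qed (use D in simp)
  have ind: "integrable M (\<lambda>x. indicator F (B x) * D x)"
    by (rule Bochner_Integration.integrable_bound[OF D]) (use F in \<open>auto simp: indicator_def\<close>)
  have "Re (CLINT x|M. indicator F (B x) * D x) = (LINT x|M. indicator F (B x) * Re (D x))"
    by (subst integral_Re[OF ind, symmetric])
       (auto intro!: Bochner_Integration.integral_cong simp: indicator_def)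
  moreover have "Im (CLINT x|M. indicator F (B x) * D x) = (LINT x|M. indicator F (B x) * Im (D x))"
    by (subst integral_Im[OF ind, symmetric])
       (auto intro!: Bochner_Integration.integral_cong simp: indicator_def)
  ultimately show ?thesis using re im by (simp add: complex_eq_iff)
qed

text \<open>
  The coordinates of a vector are measurable for the \<open>\<sigma>\<close>-algebra generated by the bounded linear
  functionals, hence so is the vector itself, as the limit of its orthonormal expansion. This
  reduces the Borel sets to preimages under functionals.
\<close>
lemma borel_eq_sigma_inner:
  "sets (borel :: 'a::{real_inner, polish_space} measure)
    = sigma_sets UNIV {(\<lambda>x. b \<bullet> x) -` F | b F. F \<in> sets (borel :: real measure)}"
    (is "_ = sigma_sets UNIV ?G")
proof
  obtain B :: "'a set" where "orthonormal_basis B" using orthonormal_basis_exists by blast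
  then obtain e :: "nat \<Rightarrow> 'a" where e: "basis_seq e" by (rule orthonormal_basis_enumeration) blast
  have inner_meas[measurable]: "(\<lambda>x. b \<bullet> x) \<in> borel_measurable (sigma UNIV ?G)" for b
    by (rule measurableI) auto
  have "(\<lambda>x. x) \<in> borel_measurable (sigma UNIV ?G)"
  proof (rule borel_measurable_LIMSEQ_metric)
    show "(\<lambda>x. \<Sum>n<N. (e n \<bullet> x) *\<^sub>R e n) \<in> borel_measurable (sigma UNIV ?G)" for N
      by measurable
    show "(\<lambda>N. \<Sum>n<N. (e n \<bullet> x) *\<^sub>R e n) \<longlonglongrightarrow> x" for x
      using basis_seq_expansion[OF e, of x] by (simp add: sums_def inner_commute)
  qed
  then have "A \<in> sets (sigma UNIV ?G)" if "A \<in> sets borel" for A :: "'a set"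
    using measurable_sets[OF _ that, of "\<lambda>x. x" "sigma UNIV ?G"] by simp
  then show "sets (borel :: 'a measure) \<subseteq> sigma_sets UNIV ?G" by auto
  have "(\<lambda>x::'a. b \<bullet> x) -` F \<in> sets borel" if "F \<in> sets borel" for b F
    using measurable_sets[OF borel_measurable_inner[OF borel_measurable_const measurable_ident] that, of b]
    by simp
  then show "sigma_sets UNIV ?G \<subseteq> sets (borel :: 'a measure)"
    by (intro sets.sigma_sets_subset[of _ borel, simplified]) auto
qed

text \<open>
  The Fourier transform determines a complex measure on the Hilbert space. The proof works with
  the class of those \<open>E\<close> for which restriction to \<open>{W \<in> E}\<close> keeps the Fourier transform of every
  weight zero. Quantifying over all weights makes this class stable under intersections, so it
  is a \<open>\<sigma>\<close>-algebra; it contains the sets \<open>{\<langle>b, W\<rangle> \<in> F}\<close> by the one-dimensional result applied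
  to the weight \<open>exp(i \<langle>v, W\<rangle>) D\<close>.
\<close>
lemma (in prob_space) fourier_null_imp_null_hilbert:
  fixes W :: "'a \<Rightarrow> 'b::{real_inner, polish_space}" and D :: "'a \<Rightarrow> complex"
  assumes W[measurable]: "W \<in> borel_measurable M" and D: "integrable M D"
    and null: "\<And>v. (CLINT x|M. iexp (v \<bullet> W x) * D x) = 0"
    and E: "E \<in> sets borel"
  shows "(CLINT x|M. indicator E (W x) * D x) = 0"
proof -
  define null_weight where "null_weight D \<longleftrightarrow>
    integrable M D \<and> (\<forall>v. (CLINT x|M. iexp (v \<bullet> W x) * D x) = 0)" for D
  define \<G> where "\<G> = {E \<in> sets borel. \<forall>D. null_weight D \<longrightarrow> null_weight (\<lambda>x. indicator E (W x) * D x)}"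
  have int_ind: "integrable M (\<lambda>x. indicator E (W x) * g x)"
    if "integrable M g" "E \<in> sets borel" for g :: "'a \<Rightarrow> complex" and E
    by (rule Bochner_Integration.integrable_bound[OF that(1)]) (use that in \<open>auto simp: indicator_def\<close>)
  have int_iexp: "integrable M (\<lambda>x. iexp (v \<bullet> W x) * g x)"
    if "integrable M g" for v and g :: "'a \<Rightarrow> complex"
    by (rule Bochner_Integration.integrable_bound[OF that]) (use that in \<open>auto simp: norm_mult\<close>)
  have "Dynkin_system UNIV \<G>"
  proof (rule Dynkin_systemI)
    show "UNIV \<in> \<G>" by (simp add: \<G>_def)
  next
    fix E assume E: "E \<in> \<G>"
    have "null_weight (\<lambda>x. indicator (UNIV - E) (W x) * D x)" if D: "null_weight D" for D
    proof -
      have ED: "null_weight (\<lambda>x. indicator E (W x) * D x)" using E D by (simp add: \<G>_def)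
      have "indicator (UNIV - E) (W x) * D x = D x - indicator E (W x) * D x" for x
        by (simp add: indicator_def)
      then show ?thesis using D ED
        by (simp add: null_weight_def right_diff_distrib int_iexp)
    qed
    then show "UNIV - E \<in> \<G>" using E by (auto simp: \<G>_def)
  next
    fix A :: "nat \<Rightarrow> 'b set" assume disj: "disjoint_family A" and A: "range A \<subseteq> \<G>"
    have A_borel: "A i \<in> sets borel" for i using A by (auto simp: \<G>_def)
    have UA: "(\<Union>i. A i) \<in> sets borel" using A_borel by auto
    have "null_weight (\<lambda>x. indicator (\<Union>i. A i) (W x) * D x)" if D: "null_weight D" for D
    proof -
      have Dint: "integrable M D" using D by (simp add: null_weight_def)
      have "(CLINT x|M. iexp (v \<bullet> W x) * (indicator (\<Union>i. A i) (W x) * D x)) = 0" for v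
      proof (rule LIMSEQ_unique)
        let ?s = "\<lambda>N x. iexp (v \<bullet> W x) * (indicator (\<Union>i<N. A i) (W x) * D x)"
        show "(\<lambda>N. CLINT x|M. ?s N x)
          \<longlonglongrightarrow> (CLINT x|M. iexp (v \<bullet> W x) * (indicator (\<Union>i. A i) (W x) * D x))"
        proof (rule integral_dominated_convergence[where w = "\<lambda>x. norm (D x)"])
          show "AE x in M. (\<lambda>N. ?s N x)
            \<longlonglongrightarrow> iexp (v \<bullet> W x) * (indicator (\<Union>i. A i) (W x) * D x)"
            by (intro AE_I2 tendsto_mult tendsto_const LIMSEQ_indicator_UN)
          show "AE x in M. norm (?s N x) \<le> norm (D x)" for N
            by (intro AE_I2) (simp add: norm_mult indicator_def)
        qed (use Dint A_borel UA in \<open>auto intro!: borel_measurable_integrable int_iexp int_ind\<close>)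
        have "(CLINT x|M. ?s N x) = 0" for N
        proof -
          have ind: "indicator (\<Union>i<N. A i) w = (\<Sum>i<N. indicator (A i) w :: complex)" for w
            using disj by (intro indicator_UN_disjoint) (auto simp: disjoint_family_on_def)
          have "(CLINT x|M. ?s N x)
              = (CLINT x|M. (\<Sum>i<N. iexp (v \<bullet> W x) * (indicator (A i) (W x) * D x)))"
            unfolding ind sum_distrib_right sum_distrib_left ..
          also have "\<dots> = (\<Sum>i<N. CLINT x|M. iexp (v \<bullet> W x) * (indicator (A i) (W x) * D x))"
            using Dint A_borel by (intro Bochner_Integration.integral_sum int_iexp int_ind)
          also have "\<dots> = 0"
            using A D by (intro sum.neutral) (auto simp: \<G>_def null_weight_def image_subset_iff)
          finally show ?thesis .
        qed
        then show "(\<lambda>N. CLINT x|M. ?s N x) \<longlonglongrightarrow> 0" by simp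
      qed
      then show ?thesis using Dint UA by (simp add: null_weight_def int_ind)
    qed
    then show "(\<Union>i. A i) \<in> \<G>" using UA by (simp add: \<G>_def)
  qed simp
  moreover have "Int_stable \<G>"
  proof (rule Int_stableI)
    fix E E' assume "E \<in> \<G>" "E' \<in> \<G>"
    moreover from this have "null_weight (\<lambda>x. indicator E (W x) * (indicator E' (W x) * D x))"
      if "null_weight D" for D
      using that by (simp add: \<G>_def)
    ultimately show "E \<inter> E' \<in> \<G>"
      unfolding \<G>_def by (simp add: sets.Int indicator_inter_arith mult.assoc)
  qed
  ultimately interpret \<G>: sigma_algebra UNIV \<G>
    using Dynkin_system.sigma_algebra_eq_Int_stable by blast
  have "(\<lambda>x. b \<bullet> x) -` F \<in> \<G>" if F: "F \<in> sets borel" for b :: 'b and F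
  proof -
    have "(\<lambda>x. b \<bullet> x) -` F \<in> sets borel" using F borel_eq_sigma_inner[where 'a='b] by blast
    moreover have "null_weight (\<lambda>x. indicator F (b \<bullet> W x) * D x)" if D: "null_weight D" for D
    proof -
      have Dint: "integrable M D" using D by (simp add: null_weight_def)
      have "(CLINT x|M. indicator F (b \<bullet> W x) * (iexp (v \<bullet> W x) * D x)) = 0" for v
      proof (rule fourier_null_imp_null[OF _ int_iexp[OF Dint] _ F])
        fix t
        have "(CLINT x|M. iexp (t * (b \<bullet> W x)) * (iexp (v \<bullet> W x) * D x))
            = (CLINT x|M. iexp ((t *\<^sub>R b + v) \<bullet> W x) * D x)"
          by (simp add: inner_add_left distrib_left exp_add mult.assoc)
        then show "(CLINT x|M. iexp (t * (b \<bullet> W x)) * (iexp (v \<bullet> W x) * D x)) = 0"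
          using D by (simp add: null_weight_def)
      qed simp
      moreover have "integrable M (\<lambda>x. indicator F (b \<bullet> W x) * D x)"
        by (rule Bochner_Integration.integrable_bound[OF Dint]) (use Dint F in \<open>auto simp: indicator_def\<close>)
      ultimately show ?thesis by (simp add: null_weight_def mult.left_commute)
    qed
    ultimately show ?thesis by (simp add: \<G>_def indicator_vimage)
  qed
  then have "sigma_sets UNIV {(\<lambda>x::'b. b \<bullet> x) -` F | b F. F \<in> sets (borel :: real measure)} \<subseteq> \<G>"
    by (intro \<G>.sigma_sets_subset) auto
  then have "E \<in> \<G>" using E unfolding borel_eq_sigma_inner[where 'a='b] by blast
  then have "null_weight (\<lambda>x. indicator E (W x) * D x)"
    using D null by (simp add: \<G>_def null_weight_def)
  from this[unfolded null_weight_def, THEN conjunct2, rule_format, of 0] show ?thesis by simp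
qed

text \<open>
  Uncorrelated images of a Gaussian vector: the characteristic functional factorizes, so
  \<open>exp(i \<langle>u, X\<rangle>) - \<phi>(u)\<close> is a weight with vanishing Fourier transform along \<open>W\<close>. Uniqueness
  replaces \<open>exp(i \<langle>v, W\<rangle>)\<close> by an indicator, and a second application with the roles of \<open>X\<close> and
  \<open>W\<close> exchanged treats the remaining exponential.
\<close>
lemma gaussian_uncorrelated_imp_independent:
  fixes X :: "'a::{real_inner, polish_space} \<Rightarrow> 'b::{real_inner, polish_space}"
    and W :: "'a \<Rightarrow> 'c::{real_inner, polish_space}"
  assumes gauss: "gaussian_measure M m C" and C: "positive_op C"
    and X: "bounded_linear X" and W: "bounded_linear W"
    and uncorrelated: "\<And>u v. C (adjoint X u) \<bullet> adjoint W v = 0"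
    and A: "A \<in> sets borel" and E: "E \<in> sets borel"
  shows "measure M (X -` A \<inter> W -` E) = measure M (X -` A) * measure M (W -` E)"
proof -
  interpret prob_space M using gauss by (simp add: gaussian_measure_def)
  have sets_M[simp, measurable_cong]: "sets M = sets borel" using gauss by (simp add: gaussian_measure_def)
  have [simp]: "space M = UNIV" using sets_eq_imp_space_eq[OF sets_M] by simp
  have lin: "linear C" and sym: "C y \<bullet> x = C x \<bullet> y" for x y
    using C by (auto simp: positive_op_def self_adjoint_op_def) (metis inner_commute)
  have X_meas[measurable]: "X \<in> borel_measurable M" and W_meas[measurable]: "W \<in> borel_measurable M"
    by (auto intro!: measurable_gaussian[OF gauss C] borel_measurable_continuous_onI
        bounded_linear.continuous_on[OF X] bounded_linear.continuous_on[OF W])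
  define \<phi> where "\<phi> b = (CLINT y|M. iexp (b \<bullet> y))" for b
  have \<phi>_add: "\<phi> (a + b) = \<phi> a * \<phi> b" if "C a \<bullet> b = 0" for a b
  proof -
    have form: "C (a + b) \<bullet> (a + b) = C a \<bullet> a + C b \<bullet> b"
      using that sym[of b a] by (simp add: linear_add[OF lin] inner_add_left inner_add_right)
    have split: "exp (- ((p + q) / 2)) = exp (- (p / 2)) * exp (- (q / 2))" for p q :: real
      by (simp add: add_divide_distrib flip: exp_add)
    show ?thesis
      unfolding \<phi>_def gaussian_characteristic_functional[OF gauss C] form split
      by (simp add: inner_add_left distrib_left exp_add mult_ac)
  qed
  have X_adj: "u \<bullet> X y = adjoint X u \<bullet> y" and W_adj: "v \<bullet> W y = adjoint W v \<bullet> y" for u v y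
    using inner_adjoint[OF X, of y u] inner_adjoint[OF W, of y v] by (simp_all add: inner_commute)
  have bounded: "integrable M f" if "f \<in> borel_measurable M" "\<And>y. cmod (f y) \<le> 1" for f
    using that by (intro integrable_const_bound[where B = 1]) auto
  have ind_W: "integrable M (\<lambda>y. indicator E (W y) :: complex)"
    by (rule bounded) (use E in \<open>auto simp: indicator_def\<close>)
  have ind_X: "integrable M (\<lambda>y. indicator A (X y) :: complex)"
    by (rule bounded) (use A in \<open>auto simp: indicator_def\<close>)
  have iexp_X: "integrable M (\<lambda>y. iexp (u \<bullet> X y))" for u by (rule bounded) auto
  have iexp_inner: "integrable M (\<lambda>y. iexp (b \<bullet> y))" for b
    by (rule bounded) (auto intro!: measurable_gaussian[OF gauss C])
  have prob_W: "(CLINT y|M. indicator E (W y)) = complex_of_real (measure M (W -` E))"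
  proof -
    have "(CLINT y|M. indicator E (W y)) = (CLINT y|M. complex_of_real (indicator (W -` E) y))"
      by (intro Bochner_Integration.integral_cong) (auto simp: indicator_def)
    then show ?thesis by simp
  qed
  have mixed: "(CLINT y|M. iexp (u \<bullet> X y) * indicator E (W y)) = \<phi> (adjoint X u) * measure M (W -` E)" for u
  proof -
    have "(CLINT y|M. indicator E (W y) * (iexp (u \<bullet> X y) - \<phi> (adjoint X u))) = 0"
    proof (rule fourier_null_imp_null_hilbert[OF W_meas _ _ E])
      fix v
      have "(CLINT y|M. iexp (v \<bullet> W y) * (iexp (u \<bullet> X y) - \<phi> (adjoint X u)))
          = (CLINT y|M. iexp ((adjoint X u + adjoint W v) \<bullet> y) - iexp (adjoint W v \<bullet> y) * \<phi> (adjoint X u))"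
        by (intro Bochner_Integration.integral_cong refl)
           (simp add: X_adj W_adj inner_add_left distrib_left exp_add right_diff_distrib mult_ac)
      also have "\<dots> = \<phi> (adjoint X u + adjoint W v) - \<phi> (adjoint W v) * \<phi> (adjoint X u)"
        unfolding \<phi>_def
        using Bochner_Integration.integral_diff[OF iexp_inner integrable_mult_left[OF iexp_inner]]
        by (simp only: integral_mult_left_zero)
      also have "\<dots> = 0" using \<phi>_add[OF uncorrelated, of u v] by simp
      finally show "(CLINT y|M. iexp (v \<bullet> W y) * (iexp (u \<bullet> X y) - \<phi> (adjoint X u))) = 0" .
    qed (intro Bochner_Integration.integrable_diff iexp_X integrable_const)
    moreover have "(CLINT y|M. indicator E (W y) * (iexp (u \<bullet> X y) - \<phi> (adjoint X u)))
        = (CLINT y|M. iexp (u \<bullet> X y) * indicator E (W y)) - (CLINT y|M. indicator E (W y)) * \<phi> (adjoint X u)"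
    proof -
      have "integrable M (\<lambda>y. iexp (u \<bullet> X y) * indicator E (W y))"
        by (rule bounded) (use E in \<open>auto simp: norm_mult indicator_def\<close>)
      from Bochner_Integration.integral_diff[OF this integrable_mult_left[OF ind_W, of "\<phi> (adjoint X u)"]]
      show ?thesis by (simp only: right_diff_distrib integral_mult_left_zero mult.commute)
    qed
    ultimately show ?thesis by (simp add: prob_W mult.commute)
  qed
  have "(CLINT y|M. indicator A (X y) * (indicator E (W y) - complex_of_real (measure M (W -` E)))) = 0"
  proof (rule fourier_null_imp_null_hilbert[OF X_meas _ _ A])
    fix u
    have "integrable M (\<lambda>y. iexp (u \<bullet> X y) * indicator E (W y))"
      by (rule bounded) (use E in \<open>auto simp: norm_mult indicator_def\<close>)
    from Bochner_Integration.integral_diff[OF this integrable_mult_left[OF iexp_X[of u], of "complex_of_real (measure M (W -` E))"]]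
    have "(CLINT y|M. iexp (u \<bullet> X y) * (indicator E (W y) - complex_of_real (measure M (W -` E))))
        = (CLINT y|M. iexp (u \<bullet> X y) * indicator E (W y)) - \<phi> (adjoint X u) * measure M (W -` E)"
      by (simp only: right_diff_distrib integral_mult_left_zero \<phi>_def X_adj)
    then show "(CLINT y|M. iexp (u \<bullet> X y) * (indicator E (W y) - complex_of_real (measure M (W -` E)))) = 0"
      by (simp only: mixed diff_self)
  qed (intro Bochner_Integration.integrable_diff ind_W integrable_const)
  moreover have "(CLINT y|M. indicator A (X y) * (indicator E (W y) - complex_of_real (measure M (W -` E))))
      = (CLINT y|M. complex_of_real (indicator (X -` A \<inter> W -` E) y - indicator (X -` A) y * measure M (W -` E)))"
    by (intro Bochner_Integration.integral_cong) (auto simp: indicator_def)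
  ultimately have "(LINT y|M. indicator (X -` A \<inter> W -` E) y - indicator (X -` A) y * measure M (W -` E)) = 0"
    by (simp only: integral_complex_of_real of_real_eq_0_iff)
  moreover have "integrable M (indicat_real S)" if "S \<in> sets M" for S
    by (rule integrable_real_indicator[OF that]) (simp add: less_top[symmetric])
  moreover have "X -` A \<in> sets M" "W -` E \<in> sets M"
    using measurable_sets[OF X_meas A] measurable_sets[OF W_meas E] by simp_all
  ultimately show ?thesis by (subst (asm) Bochner_Integration.integral_diff) auto
qed

text \<open>
  Preimages under one map already form a \<open>\<sigma>\<close>-algebra, so the generated \<open>\<sigma>\<close>-algebras in the
  definition of independence contain nothing beyond preimages.
\<close>
lemma indep_random_variablesI:
  assumes "prob_space M" and X: "X \<in> measurable M N" and Z: "Z \<in> measurable M L"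
    and indep: "\<And>A B. A \<in> sets N \<Longrightarrow> B \<in> sets L \<Longrightarrow>
      measure M ((X -` A \<inter> space M) \<inter> (Z -` B \<inter> space M))
        = measure M (X -` A \<inter> space M) * measure M (Z -` B \<inter> space M)"
  shows "indep_random_variables M N X L Z"
proof -
  interpret prob_space M by fact
  have vimage: "sigma_sets (space M) {f -` A \<inter> space M | A. A \<in> sets R} = {f -` A \<inter> space M | A. A \<in> sets R}"
    if "f \<in> measurable M R" for f R
    using sigma_sets_vimage_commute[of f "space M" "space R" "sets R"] measurable_space[OF that]
    by (simp add: sets.sigma_sets_eq Pi_def)
  show ?thesis
    unfolding indep_random_variables_def vimage[OF X] vimage[OF Z]
    using X Z by (auto intro!: indep_setI indep dest: measurable_sets)
qed

section \<open>The variance estimator\<close>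

theorem proposition7p2:
  fixes U :: "'a::{real_inner, polish_space} set"
    and Q T S :: "'a \<Rightarrow> 'a"
    and Y \<zeta>_hat :: "'a \<Rightarrow> 'a"
    and P :: "'a \<times> real \<Rightarrow> 'a measure"
    and \<Theta> :: "('a \<times> real) set"
  assumes U: "subspace U" "closed U"
    and Q: "bounded_linear Q" "nonneg_op Q" "self_adjoint_op Q" "nuclear_op Q"
    and Q_inv: "invariant_under Q U" "invariant_under Q (U\<^sup>\<bottom>)"
    and \<Theta>: "\<Theta> = U \<times> {0<..}"
    and P: "\<And>\<zeta> \<sigma>. (\<zeta>, \<sigma>) \<in> \<Theta> \<Longrightarrow> gaussian_measure (P (\<zeta>, \<sigma>)) \<zeta> (\<lambda>x. \<sigma>\<^sup>2 *\<^sub>R Q x)"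
    and Y: "Y = (\<lambda>y. y)"
    and \<zeta>_hat: "\<zeta>_hat = (\<lambda>y. orth_proj U (Y y))"
    and T: "bounded_linear T" "U \<subseteq> {x. T x = 0}" "op_trace (T \<circ> Q \<circ> adjoint T) > 0"
    and S: "S = (\<lambda>x. T x /\<^sub>R sqrt (op_trace (T \<circ> Q \<circ> adjoint T)))"
  shows "unbiased_estimator P \<Theta> (\<lambda>y. (norm (S (Y y)))\<^sup>2) (\<lambda>(\<zeta>, \<sigma>). \<sigma>\<^sup>2)
    \<and> (\<forall>\<theta>\<in>\<Theta>. indep_random_variables (P \<theta>) borel \<zeta>_hat borel (\<lambda>y. (norm (S (Y y)))\<^sup>2))
    \<and> (\<forall>(\<zeta>, \<sigma>)\<in>\<Theta>. quadratic_risk (P (\<zeta>, \<sigma>)) (\<lambda>y. (norm (S (Y y)))\<^sup>2) (\<sigma>\<^sup>2)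
          = ennreal (2 * (\<sigma>\<^sup>2 * (hilbert_schmidt_norm (T \<circ> Q \<circ> adjoint T)
                                / nuclear_norm (T \<circ> Q \<circ> adjoint T)))\<^sup>2))
    \<and> (\<forall>(\<zeta>, \<sigma>)\<in>\<Theta>. quadratic_risk (P (\<zeta>, \<sigma>)) (\<lambda>y. (norm (S (Y y)))\<^sup>2) (\<sigma>\<^sup>2)
          \<le> ennreal (2 * \<sigma> ^ 4))"
proof -
  define K where "K = T \<circ> Q \<circ> adjoint T"
  define t where "t = op_trace K"
  define B where "B = (SOME B :: 'a set. orthonormal_basis B)"
  have t: "t > 0" using T(3) by (simp add: t_def K_def)
  have S_t: "S = (\<lambda>x. T x /\<^sub>R sqrt t)" by (simp add: S t_def K_def)
  have Q_pos: "positive_op Q"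
    using Q by (simp add: positive_op_def bounded_linear.linear)
  have K_bl: "bounded_linear K"
    unfolding K_def by (intro bounded_linear_compose[unfolded comp_def[symmetric]] T Q bounded_linear_adjoint)
  have K_pos: "positive_op K"
    using Q K_bl unfolding positive_op_def self_adjoint_op_def nonneg_op_def K_def
    by (simp add: bounded_linear.linear inner_adjoint[OF T(1)])
       (metis inner_adjoint[OF T(1)] inner_commute)
  have "orthonormal_basis B" unfolding B_def by (rule someI_ex[OF orthonormal_basis_exists])
  then obtain e where e: "basis_seq e" and has_sum_B:
    "\<And>f s. f 0 = 0 \<Longrightarrow> (\<And>x. f x \<ge> (0::real)) \<Longrightarrow> (f has_sum s) B \<longleftrightarrow> (\<lambda>n. f (e n)) sums s"
    using orthonormal_basis_enumeration by metis
  \<comment> \<open>An unordered sum without limit is zero, so a positive trace entails summability.\<close>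
  have "((\<lambda>x. K x \<bullet> x) has_sum t) B"
    using t has_sum_infsum[of "\<lambda>x. K x \<bullet> x" B] infsum_not_exists[of "\<lambda>x. K x \<bullet> x" B]
    unfolding t_def op_trace_def B_def by fastforce
  then have tr: "(\<lambda>n. K (e n) \<bullet> e n) sums t"
    using K_pos by (subst (asm) has_sum_B) (auto simp: positive_op_def nonneg_op_def)
  define h where "h = (\<Sum>n. (norm (K (e n)))\<^sup>2)"
  have hs: "(\<lambda>n. (norm (K (e n)))\<^sup>2) sums h" and h_le: "h \<le> t\<^sup>2"
    using hilbert_schmidt_le_trace[OF K_pos e tr] by (auto simp: h_def)
  have h0: "h \<ge> 0" by (intro sums_le[OF _ sums_zero hs]) simp
  have "((\<lambda>x. (norm (K x))\<^sup>2) has_sum h) B"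
    using hs K_bl by (subst has_sum_B) (auto simp: linear_0 bounded_linear.linear)
  then have K_hs: "hilbert_schmidt_norm K = sqrt h"
    unfolding hilbert_schmidt_norm_def B_def[symmetric] by (simp add: infsumI)
  have K_nuc: "nuclear_norm K = t" by (rule nuclear_norm_positive_op[OF K_pos K_bl e tr])

  have main: "integrable M (\<lambda>y. (norm (S y))\<^sup>2) \<and> (LINT y|M. (norm (S y))\<^sup>2) = \<sigma>\<^sup>2"
    "quadratic_risk M (\<lambda>y. (norm (S y))\<^sup>2) (\<sigma>\<^sup>2) = ennreal (2 * \<sigma> ^ 4 * h / t\<^sup>2)"
    "indep_random_variables M borel (orth_proj U) borel (\<lambda>y. (norm (S y))\<^sup>2)"
    if \<zeta>: "\<zeta> \<in> U" and M: "gaussian_measure M \<zeta> (\<lambda>x. \<sigma>\<^sup>2 *\<^sub>R Q x)" for M \<zeta> \<sigma>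
  proof -
    let ?C = "\<lambda>x. \<sigma>\<^sup>2 *\<^sub>R Q x"
    interpret prob_space M using M by (simp add: gaussian_measure_def)
    have C: "positive_op ?C"
      using Q_pos by (auto simp: positive_op_def self_adjoint_op_def nonneg_op_def linear_compose_scale_right)
    have T\<zeta>: "T \<zeta> = 0" using \<zeta> T(2) by auto
    have cov: "(T \<circ> ?C \<circ> adjoint T) x = \<sigma>\<^sup>2 *\<^sub>R K x" for x
      by (simp add: K_def linear_scale[OF bounded_linear.linear[OF T(1)]])
    have "(\<lambda>n. (T \<circ> ?C \<circ> adjoint T) (e n) \<bullet> e n) sums (\<sigma>\<^sup>2 * t)"
      unfolding cov using sums_mult[OF tr, of "\<sigma>\<^sup>2"] by simp
    moreover have "(\<lambda>n. (norm ((T \<circ> ?C \<circ> adjoint T) (e n)))\<^sup>2) sums (\<sigma> ^ 4 * h)"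
      unfolding cov using sums_mult[OF hs, of "\<sigma> ^ 4"]
      by (simp add: power_mult_distrib flip: power_mult)
    ultimately have m2: "has_bochner_integral M (\<lambda>y. (norm (T y))\<^sup>2) (\<sigma>\<^sup>2 * t)"
      and m4: "has_bochner_integral M (\<lambda>y. (norm (T y)) ^ 4) ((\<sigma>\<^sup>2 * t)\<^sup>2 + 2 * (\<sigma> ^ 4 * h))"
      using gaussian_norm_moments[OF M C T(1) T\<zeta> e refl] by blast+
    have S_norm: "(norm (S y))\<^sup>2 = (norm (T y))\<^sup>2 / t" for y
      using t by (simp add: S_t power_mult_distrib power_divide divide_inverse power_inverse mult.commute)
    have "has_bochner_integral M (\<lambda>y. (norm (S y))\<^sup>2) (\<sigma>\<^sup>2 * t / t)"
      unfolding S_norm by (rule has_bochner_integral_divide_zero[OF m2])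
    then show "integrable M (\<lambda>y. (norm (S y))\<^sup>2) \<and> (LINT y|M. (norm (S y))\<^sup>2) = \<sigma>\<^sup>2"
      using t by (simp add: has_bochner_integral_iff)
    have expand: "\<bar>(norm (S y))\<^sup>2 - \<sigma>\<^sup>2\<bar>\<^sup>2 = (norm (T y)) ^ 4 / t\<^sup>2 - (2 * \<sigma>\<^sup>2 / t) * (norm (T y))\<^sup>2 + \<sigma> ^ 4" for y
      unfolding S_norm power2_abs
      by (simp add: power2_diff power_divide mult_ac flip: power_mult)
    have const: "has_bochner_integral M (\<lambda>y. \<sigma> ^ 4) (\<sigma> ^ 4)"
      by (simp add: has_bochner_integral_iff prob_space)
    have "has_bochner_integral M (\<lambda>y. \<bar>(norm (S y))\<^sup>2 - \<sigma>\<^sup>2\<bar>\<^sup>2)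
        (((\<sigma>\<^sup>2 * t)\<^sup>2 + 2 * (\<sigma> ^ 4 * h)) / t\<^sup>2 - (2 * \<sigma>\<^sup>2 / t) * (\<sigma>\<^sup>2 * t) + \<sigma> ^ 4)"
      unfolding expand
      by (intro has_bochner_integral_add has_bochner_integral_diff has_bochner_integral_divide_zero
          has_bochner_integral_mult_right m2 m4 const)
    moreover have "((\<sigma>\<^sup>2 * t)\<^sup>2 + 2 * (\<sigma> ^ 4 * h)) / t\<^sup>2 - (2 * \<sigma>\<^sup>2 / t) * (\<sigma>\<^sup>2 * t) + \<sigma> ^ 4
        = 2 * \<sigma> ^ 4 * h / t\<^sup>2"
      using t by (simp add: field_simps power2_eq_square power4_eq_xxxx)
    ultimately show "quadratic_risk M (\<lambda>y. (norm (S y))\<^sup>2) (\<sigma>\<^sup>2) = ennreal (2 * \<sigma> ^ 4 * h / t\<^sup>2)"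
      unfolding quadratic_risk_def
      by (subst nn_integral_eq_integral) (auto simp: has_bochner_integral_iff)
    show "indep_random_variables M borel (orth_proj U) borel (\<lambda>y. (norm (S y))\<^sup>2)"
    proof (rule indep_random_variablesI)
      have space: "space M = UNIV"
        using M sets_eq_imp_space_eq[of M borel] by (simp add: gaussian_measure_def)
      note proj = bounded_linear_orth_proj[OF U]
      show "orth_proj U \<in> borel_measurable M"
        by (intro measurable_gaussian[OF M C] borel_measurable_continuous_onI bounded_linear.continuous_on[OF proj] continuous_on_id)
      show "(\<lambda>y. (norm (S y))\<^sup>2) \<in> borel_measurable M"
        unfolding S_norm
        by (intro measurable_gaussian[OF M C] borel_measurable_continuous_onI continuous_intros
            bounded_linear.continuous_on[OF T(1)]) (use t in auto)
      \<comment> \<open>The ranges of the two adjoints are \<open>U\<close> and a subset of its orthogonal complement, which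
        the covariance operator does not mix.\<close>
      have "?C (adjoint (orth_proj U) u) \<bullet> adjoint T v = 0" for u v
      proof -
        have "adjoint (orth_proj U) u = orth_proj U u"
          by (metis adjoint_unique orth_proj_self_adjoint[OF U])
        then have "Q (adjoint (orth_proj U) u) \<in> U"
          using orth_proj_mem[OF U] Q_inv(1) by (auto simp: invariant_under_def)
        then show ?thesis using T(2) inner_adjoint[OF T(1)] by (metis (mono_tags, lifting) inner_scaleR_left inner_zero_left mem_Collect_eq mult_zero_right subsetD)
      qed
      note indep = gaussian_uncorrelated_imp_independent[OF M C proj T(1) this]
      fix A :: "'a set" and F :: "real set"
      assume A: "A \<in> sets borel" and F: "F \<in> sets borel"
      define E where "E = (\<lambda>z::'a. (norm z)\<^sup>2 / t) -` F"
      have "(\<lambda>z::'a. (norm z)\<^sup>2 / t) \<in> borel_measurable borel" by simp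
      from measurable_sets[OF this F] have "E \<in> sets borel" by (simp add: E_def)
      moreover have "(\<lambda>y. (norm (S y))\<^sup>2) -` F = T -` E" by (auto simp: S_norm E_def)
      ultimately show "measure M ((orth_proj U -` A \<inter> space M) \<inter> ((\<lambda>y. (norm (S y))\<^sup>2) -` F \<inter> space M))
        = measure M (orth_proj U -` A \<inter> space M) * measure M ((\<lambda>y. (norm (S y))\<^sup>2) -` F \<inter> space M)"
        using indep[OF A] by (simp add: space)
    qed (rule prob_space_axioms)
  qed
  have risk: "2 * \<sigma> ^ 4 * h / t\<^sup>2 = 2 * (\<sigma>\<^sup>2 * (sqrt h / t))\<^sup>2" for \<sigma> :: real
    using h0 by (simp add: power_mult_distrib power_divide flip: power_mult)
  have risk_le: "2 * \<sigma> ^ 4 * h / t\<^sup>2 \<le> 2 * \<sigma> ^ 4" for \<sigma> :: real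
  proof -
    have "(2 * \<sigma> ^ 4) * (h / t\<^sup>2) \<le> (2 * \<sigma> ^ 4) * 1"
      using h_le t by (intro mult_left_mono) auto
    then show ?thesis by simp
  qed
  have \<zeta>_hat': "\<zeta>_hat = orth_proj U" by (simp add: \<zeta>_hat Y)
  have pointwise: "integrable (P (\<zeta>, \<sigma>)) (\<lambda>y. (norm (S y))\<^sup>2)
      \<and> (LINT y|P (\<zeta>, \<sigma>). (norm (S y))\<^sup>2) = \<sigma>\<^sup>2"
    "quadratic_risk (P (\<zeta>, \<sigma>)) (\<lambda>y. (norm (S y))\<^sup>2) (\<sigma>\<^sup>2) = ennreal (2 * \<sigma> ^ 4 * h / t\<^sup>2)"
    "indep_random_variables (P (\<zeta>, \<sigma>)) borel (orth_proj U) borel (\<lambda>y. (norm (S y))\<^sup>2)"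
    if "(\<zeta>, \<sigma>) \<in> \<Theta>" for \<zeta> \<sigma>
  proof -
    have "\<zeta> \<in> U" using that \<Theta> by simp
    from main[OF this P[OF that]] show
      "integrable (P (\<zeta>, \<sigma>)) (\<lambda>y. (norm (S y))\<^sup>2)
        \<and> (LINT y|P (\<zeta>, \<sigma>). (norm (S y))\<^sup>2) = \<sigma>\<^sup>2"
      "quadratic_risk (P (\<zeta>, \<sigma>)) (\<lambda>y. (norm (S y))\<^sup>2) (\<sigma>\<^sup>2) = ennreal (2 * \<sigma> ^ 4 * h / t\<^sup>2)"
      "indep_random_variables (P (\<zeta>, \<sigma>)) borel (orth_proj U) borel (\<lambda>y. (norm (S y))\<^sup>2)" .
  qed
  show ?thesis
    unfolding K_def[symmetric] K_hs K_nuc unbiased_estimator_def \<zeta>_hat' unfolding Y risk[symmetric]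
  proof (intro conjI ballI)
    fix \<theta> assume \<theta>: "\<theta> \<in> \<Theta>"
    obtain \<zeta> \<sigma> where \<theta>_eq: "\<theta> = (\<zeta>, \<sigma>)" by (cases \<theta>)
    note at_\<theta> = pointwise[OF \<theta>[unfolded \<theta>_eq]]
    show "integrable (P \<theta>) (\<lambda>y. (norm (S y))\<^sup>2)"
      and "(LINT y|P \<theta>. (norm (S y))\<^sup>2) = (case \<theta> of (\<zeta>, \<sigma>) \<Rightarrow> \<sigma>\<^sup>2)"
      using at_\<theta>(1) by (simp_all add: \<theta>_eq)
    show "indep_random_variables (P \<theta>) borel (orth_proj U) borel (\<lambda>y. (norm (S y))\<^sup>2)"
      unfolding \<theta>_eq by (rule at_\<theta>(3))
    show "case \<theta> of (\<zeta>, \<sigma>) \<Rightarrow> quadratic_risk (P (\<zeta>, \<sigma>)) (\<lambda>y. (norm (S y))\<^sup>2) (\<sigma>\<^sup>2)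
        = ennreal (2 * \<sigma> ^ 4 * h / t\<^sup>2)"
      and "case \<theta> of (\<zeta>, \<sigma>) \<Rightarrow> quadratic_risk (P (\<zeta>, \<sigma>)) (\<lambda>y. (norm (S y))\<^sup>2) (\<sigma>\<^sup>2)
        \<le> ennreal (2 * \<sigma> ^ 4)"
      unfolding \<theta>_eq case_prod_conv at_\<theta>(2) using risk_le by (auto intro: ennreal_leI)
  qed
qed

end
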